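(* Let $M$ be a convex $\sigma$-MV-algebra and $\tau$ a $\sigma$-additive strong state operator on $M$. Then there is a convex $\sigma$-MV-subalgebra $N$ of $M$ and a ($\sigma$-additive) state $m$ on $M$ such that for every $a\in M$, $\tau^*(a^* )$ is an MV-conditional expectation of $a$ with respect to $N$ in $m$.
   Context: MV-algebras $(M;\boxplus,{}',0)$ are regarded as effect algebras: with $a\boxdot b=(a'\boxplus b')'$, the orthosum $a\oplus b:=a\boxplus b$ is defined iff $a\boxdot b=0$. A $\sigma$-MV-algebra is an MV-algebra that is a $\sigma$-lattice; a $\sigma$-MV-subalgebra is a sub-MV-algebra closed under countable suprema of $M$. $M$ is convex if there is a map $[0,1]\times M\to M$, $(\lambda,a)\mapsto\lambda a$, with $\alpha(\beta a)=(\alpha\beta)a$; $(\alpha+\beta)a=\alpha a\oplus\beta a$ if $\alpha+\beta\le1$; $\lambda(a\oplus b)=\lambda a\oplus\lambda b$ if $a\oplus b$ is defined; $1a=a$. A sub-MV-algebra $N$ of $M$ is convex if $a\in N$, $\alpha\in[0,1]$ imply $\alpha a\in N$. A state is a map $m:M\to[0,1]$ with $m(1)=1$ and $m(a\oplus b)=m(a)+m(b)$ whenever $a\oplus b$ is defined; it is $\sigma$-additive if $a_n\nearrow a$ implies $m(a_n)\nearrow m(a)$. A state operator on $M$ is a map $\tau:M\to M$ with $\tau(1)=1$; $\tau(e\oplus f)=\tau(e)\oplus\tau(f)$ whenever $e\oplus f$ is defined; $\tau\circ\tau=\tau$. It is strong if $\tau(\tau(a)\wedge\tau(b))=\tau(a)\wedge\tau(b)$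 for all $a,b$, and $\sigma$-additive if $a_n\nearrow a$ implies $\tau(a_n)\nearrow\tau(a)$. A tribe over a set $X$ is a set $\mathcal T\subseteq[0,1]^X$ containing $0$ and closed under $f\mapsto 1-f$, $(f,g)\mapsto\min(f+g,1)$, and pointwise limits of increasing sequences; $\mathcal B(\mathcal T)$ denotes the $\sigma$-algebra of sets $B\subseteq X$ with $\chi_B\in\mathcal T$. For an MV-algebra $N$, $\mathcal B(N)=\{a\in N:a\boxplus a=a\}$. Loomis–Sikorski representation: let $X$ be the compact Hausdorff space of extremal (finitely additive) states on $M$ and $a^*(\omega)=\omega(a)$ for $a\in M$, $\omega\in X$. There is a tribe $M^*$ over $X$ and a $\sigma$-homomorphism $\eta$ of $M^*$ onto $M$ such that $a^*$ is the unique continuous function in $M^*$ with $\eta(a^* )=a$, and $f\in M^*$ has $\eta(f)=a$ iff $\{f\neq a^*\}$ is meager. For a convex $\sigma$-MV-algebra $M$, $a\mapsto a^*$ is an MV-algebra isomorphism of $M$ onto $C_1(X)$, the continuous functions $X\to[0,1]$, and $\tau^*:C_1(X)\to C_1(X)$ is defined by $\tau^*(a^* ):=\tau(a)^*$. For a $\sigma$-MV-subalgebra $N$, $N^*$ is the sub-tribe of $M^*$ generated by $\{b^*:b\in N\}$. For a $\sigma$-additive state $m$ put $m^*=m\circ\eta$, and for $b\in M$ put $P^*_{b^*}(A)=m^*(b^*\wedge\chi_A)$, $A\in\mathcal B(M^* )$. An MV-conditional expectation of $a\in M$ given (with respect to) $N$ in the state $m$ is a $\mathcal B(N^* )$-measurable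 function $g:X\to\mathbb R$ such that $\int_X g\,dP^*_{b^*}=m(a\wedge b)$ for all $b\in\mathcal B(N)$.
   Formalization: The formal theorem additionally assumes that M carries at least one σ-additive state; this is necessary, since e.g. C(X,[0,1]) for X the Stone space of the regular open algebra of the reals, with τ the identity, has none. *)

theory Defs
  imports "HOL-Analysis.Analysis" "HOL-Library.Countable_Complete_Lattices"
begin

section \<open>MV-algebras\<close>

class mv_algebra = zero + one +
  fixes mv_plus :: "'a \<Rightarrow> 'a \<Rightarrow> 'a" (infixl "\<boxplus>" 65)
    and mv_neg :: "'a \<Rightarrow> 'a"
  assumes mv_assoc: "(a \<boxplus> b) \<boxplus> c = a \<boxplus> (b \<boxplus> c)"
    and mv_commute: "a \<boxplus> b = b \<boxplus> a"
    and mv_zero: "a \<boxplus> 0 = a"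
    and mv_neg_neg: "mv_neg (mv_neg a) = a"
    and mv_one: "1 = mv_neg 0"
    and mv_plus_one: "a \<boxplus> 1 = 1"
    and mv_lukasiewicz: "mv_neg (mv_neg a \<boxplus> b) \<boxplus> b = mv_neg (mv_neg b \<boxplus> a) \<boxplus> a"
begin

definition mv_times :: "'a \<Rightarrow> 'a \<Rightarrow> 'a" (infixl "\<boxdot>" 70)
  where "a \<boxdot> b = mv_neg (mv_neg a \<boxplus> mv_neg b)"

text \<open>The partial operation of the effect algebra is represented by its domain
  \<^term>\<open>orthogonal_mv\<close>; where it is defined, its value is \<^term>\<open>a \<boxplus> b\<close>.\<close>

definition orthogonal_mv :: "'a \<Rightarrow> 'a \<Rightarrow> bool"
  where "orthogonal_mv a b \<longleftrightarrow> a \<boxdot> b = 0"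

end

text \<open>The last axiom says that the lattice order is the natural order of the MV-algebra, so
  \<^term>\<open>inf\<close>, \<^term>\<open>sup\<close> and the countable \<^term>\<open>Inf\<close>, \<^term>\<open>Sup\<close> are those of the MV-algebra
  (and \<^term>\<open>bot\<close>, \<^term>\<open>top\<close> coincide with 0, 1).  \<^term>\<open>Sup A\<close> carries no information
  when \<^term>\<open>A\<close> is uncountable.\<close>

class sigma_mv_algebra = mv_algebra + countable_complete_lattice +
  assumes mv_le_iff: "a \<le> b \<longleftrightarrow> mv_neg a \<boxplus> b = 1"

text \<open>Only the values \<^term>\<open>mv_scale r a\<close> with \<^term>\<open>r \<in> {0..1}\<close> matter.\<close>

class convex_mv_algebra = mv_algebra +
  fixes mv_scale :: "real \<Rightarrow> 'a \<Rightarrow> 'a"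
  assumes mv_scale_scale:
      "r \<in> {0..1} \<Longrightarrow> s \<in> {0..1} \<Longrightarrow> mv_scale r (mv_scale s a) = mv_scale (r * s) a"
    and mv_scale_add_left:
      "r \<in> {0..1} \<Longrightarrow> s \<in> {0..1} \<Longrightarrow> r + s \<le> 1 \<Longrightarrow>
         orthogonal_mv (mv_scale r a) (mv_scale s a) \<and>
         mv_scale (r + s) a = mv_scale r a \<boxplus> mv_scale s a"
    and mv_scale_add_right:
      "r \<in> {0..1} \<Longrightarrow> orthogonal_mv a b \<Longrightarrow>
         orthogonal_mv (mv_scale r a) (mv_scale r b) \<and>
         mv_scale r (a \<boxplus> b) = mv_scale r a \<boxplus> mv_scale r b"
    and mv_scale_one: "mv_scale 1 a = a"

class convex_sigma_mv_algebra = convex_mv_algebra + sigma_mv_algebra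

definition sub_mv_algebra :: "'a::mv_algebra set \<Rightarrow> bool"
  where "sub_mv_algebra N \<longleftrightarrow>
    0 \<in> N \<and> (\<forall>a\<in>N. mv_neg a \<in> N) \<and> (\<forall>a\<in>N. \<forall>b\<in>N. a \<boxplus> b \<in> N)"

definition sigma_mv_subalgebra :: "'a::sigma_mv_algebra set \<Rightarrow> bool"
  where "sigma_mv_subalgebra N \<longleftrightarrow>
    sub_mv_algebra N \<and> (\<forall>A. countable A \<longrightarrow> A \<subseteq> N \<longrightarrow> Sup A \<in> N)"

definition convex_sub :: "'a::convex_mv_algebra set \<Rightarrow> bool"
  where "convex_sub N \<longleftrightarrow> (\<forall>a\<in>N. \<forall>r\<in>{0..1}. mv_scale r a \<in> N)"

definition boolean_elements :: "'a::mv_algebra set \<Rightarrow> 'a set"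
  where "boolean_elements N = {a \<in> N. a \<boxplus> a = a}"


section \<open>States and state operators\<close>

text \<open>\<^term>\<open>increases_to u l\<close>: the sequence \<^term>\<open>u\<close> is increasing with least upper bound \<^term>\<open>l\<close>;
  for real sequences this means increasing convergence.\<close>

definition increases_to :: "(nat \<Rightarrow> 'b::order) \<Rightarrow> 'b \<Rightarrow> bool"
  where "increases_to u l \<longleftrightarrow>
    incseq u \<and> (\<forall>n. u n \<le> l) \<and> (\<forall>v. (\<forall>n. u n \<le> v) \<longrightarrow> l \<le> v)"

definition mv_state :: "('a::mv_algebra \<Rightarrow> real) \<Rightarrow> bool"
  where "mv_state m \<longleftrightarrow>
    (\<forall>a. m a \<in> {0..1}) \<and> m 1 = 1 \<and>
    (\<forall>a b. orthogonal_mv a b \<longrightarrow> m (a \<boxplus> b) = m a + m b)"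

definition sigma_additive_state :: "('a::sigma_mv_algebra \<Rightarrow> real) \<Rightarrow> bool"
  where "sigma_additive_state m \<longleftrightarrow>
    mv_state m \<and>
    (\<forall>u a. increases_to u a \<longrightarrow> increases_to (\<lambda>n. m (u n)) (m a))"

definition state_operator :: "('a::mv_algebra \<Rightarrow> 'a) \<Rightarrow> bool"
  where "state_operator \<tau> \<longleftrightarrow>
    \<tau> 1 = 1 \<and>
    (\<forall>e f. orthogonal_mv e f \<longrightarrow>
       orthogonal_mv (\<tau> e) (\<tau> f) \<and> \<tau> (e \<boxplus> f) = \<tau> e \<boxplus> \<tau> f) \<and>
    (\<forall>a. \<tau> (\<tau> a) = \<tau> a)"

definition strong_state_operator :: "('a::sigma_mv_algebra \<Rightarrow> 'a) \<Rightarrow> bool"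
  where "strong_state_operator \<tau> \<longleftrightarrow>
    state_operator \<tau> \<and> (\<forall>a b. \<tau> (inf (\<tau> a) (\<tau> b)) = inf (\<tau> a) (\<tau> b))"

definition sigma_additive_operator :: "('a::sigma_mv_algebra \<Rightarrow> 'a) \<Rightarrow> bool"
  where "sigma_additive_operator \<tau> \<longleftrightarrow>
    (\<forall>u a. increases_to u a \<longrightarrow> increases_to (\<lambda>n. \<tau> (u n)) (\<tau> a))"


section \<open>Tribes\<close>

text \<open>Functions on a set \<^term>\<open>X\<close> are represented extensionally, i.e. they are
  \<^term>\<open>undefined\<close> outside \<^term>\<open>X\<close>.\<close>

definition chi :: "'x set \<Rightarrow> 'x set \<Rightarrow> 'x \<Rightarrow> real"
  where "chi X B = (\<lambda>x\<in>X. indicator B x)"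

definition tribe :: "'x set \<Rightarrow> ('x \<Rightarrow> real) set \<Rightarrow> bool"
  where "tribe X T \<longleftrightarrow>
    T \<subseteq> (X \<rightarrow>\<^sub>E {0..1}) \<and>
    (\<lambda>x\<in>X. 0) \<in> T \<and>
    (\<forall>f\<in>T. (\<lambda>x\<in>X. 1 - f x) \<in> T) \<and>
    (\<forall>f\<in>T. \<forall>g\<in>T. (\<lambda>x\<in>X. min (f x + g x) 1) \<in> T) \<and>
    (\<forall>u f. (\<forall>n. u n \<in> T) \<longrightarrow> f \<in> extensional X \<longrightarrow>
       (\<forall>x\<in>X. increases_to (\<lambda>n. u n x) (f x)) \<longrightarrow> f \<in> T)"

definition generated_tribe :: "'x set \<Rightarrow> ('x \<Rightarrow> real) set \<Rightarrow> ('x \<Rightarrow> real) set"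
  where "generated_tribe X G = \<Inter> {T. tribe X T \<and> G \<subseteq> T}"

definition tribe_sets :: "'x set \<Rightarrow> ('x \<Rightarrow> real) set \<Rightarrow> 'x set set"
  where "tribe_sets X T = {B. B \<subseteq> X \<and> chi X B \<in> T}"

definition nowhere_dense_in :: "'x topology \<Rightarrow> 'x set \<Rightarrow> bool"
  where "nowhere_dense_in U S \<longleftrightarrow>
    S \<subseteq> topspace U \<and> U interior_of (U closure_of S) = {}"

definition meager_in :: "'x topology \<Rightarrow> 'x set \<Rightarrow> bool"
  where "meager_in U S \<longleftrightarrow>
    (\<exists>F. countable F \<and> (\<forall>A\<in>F. nowhere_dense_in U A) \<and> S = \<Union> F)"


section \<open>Loomis--Sikorski representation\<close>

definition extremal_state :: "('a::mv_algebra \<Rightarrow> real) \<Rightarrow> bool"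
  where "extremal_state \<omega> \<longleftrightarrow>
    mv_state \<omega> \<and>
    (\<forall>m1 m2 t. mv_state m1 \<longrightarrow> mv_state m2 \<longrightarrow> 0 < t \<longrightarrow> t < 1 \<longrightarrow>
       \<omega> = (\<lambda>a. t * m1 a + (1 - t) * m2 a) \<longrightarrow> m1 = \<omega> \<and> m2 = \<omega>)"

abbreviation XM :: "('a::mv_algebra \<Rightarrow> real) set"
  where "XM \<equiv> {\<omega>. extremal_state \<omega>}"

text \<open>The topology of the function space \<^typ>\<open>'a \<Rightarrow> real\<close> is the product topology, so the
  topology induced on the set of extremal states is that of pointwise convergence.\<close>

abbreviation topXM :: "('a::mv_algebra \<Rightarrow> real) topology"
  where "topXM \<equiv> top_of_set XM"

definition star :: "'a::mv_algebra \<Rightarrow> ('a \<Rightarrow> real) \<Rightarrow> real"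
  where "star a = (\<lambda>\<omega>\<in>XM. \<omega> a)"

definition C1 :: "(('a::mv_algebra \<Rightarrow> real) \<Rightarrow> real) set"
  where "C1 = {f \<in> XM \<rightarrow>\<^sub>E {0..1}. continuous_map topXM euclideanreal f}"

text \<open>The tribe of a subset \<^term>\<open>N\<close>; the tribe of the whole algebra is \<^term>\<open>star_tribe UNIV\<close>.\<close>

definition star_tribe :: "'a::mv_algebra set \<Rightarrow> (('a \<Rightarrow> real) \<Rightarrow> real) set"
  where "star_tribe N = generated_tribe XM (star ` N)"

definition eta :: "(('a::mv_algebra \<Rightarrow> real) \<Rightarrow> real) \<Rightarrow> 'a"
  where "eta f = (THE a. meager_in topXM {\<omega> \<in> XM. f \<omega> \<noteq> star a \<omega>})"

definition state_star :: "('a::mv_algebra \<Rightarrow> real) \<Rightarrow> (('a \<Rightarrow> real) \<Rightarrow> real) \<Rightarrow> real"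
  where "state_star m = m \<circ> eta"

definition operator_star ::
  "('a::mv_algebra \<Rightarrow> 'a) \<Rightarrow> (('a \<Rightarrow> real) \<Rightarrow> real) \<Rightarrow> (('a \<Rightarrow> real) \<Rightarrow> real)"
  where "operator_star \<tau> = (\<lambda>f\<in>C1. star (\<tau> (the_inv star f)))"


section \<open>Conditional expectations\<close>

definition P_star :: "('a::mv_algebra \<Rightarrow> real) \<Rightarrow> 'a \<Rightarrow> ('a \<Rightarrow> real) measure"
  where "P_star m b =
    measure_of XM (tribe_sets XM (star_tribe UNIV))
      (\<lambda>A. ennreal (state_star m (\<lambda>\<omega>\<in>XM. min (star b \<omega>) (chi XM A \<omega>))))"

text \<open>\<^term>\<open>has_bochner_integral\<close> expresses integrability together with the value of the integral.\<close>

definition mv_cond_exp ::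
  "'a::sigma_mv_algebra set \<Rightarrow> ('a \<Rightarrow> real) \<Rightarrow> 'a \<Rightarrow> (('a \<Rightarrow> real) \<Rightarrow> real) \<Rightarrow> bool"
  where "mv_cond_exp N m a g \<longleftrightarrow>
    g \<in> borel_measurable (sigma XM (tribe_sets XM (star_tribe N))) \<and>
    (\<forall>b \<in> boolean_elements N. has_bochner_integral (P_star m b) g (m (inf a b)))"

end

(*
  Take N = range tau and m = s o tau for a sigma-additive state s.  If b is a Boolean element of N,
  then tau (inf a b) = inf (tau a) b, so m (inf a b) = m (inf (tau a) b), and everything reduces to
  the integral representation m (inf c b) = integral of c* with respect to P*_{b*}, for every c.
  For that, extremal states are exactly the lattice homomorphisms among the states (an extremal
  state is proportional to its component on the band generated by any element), and they separate
  points because prime ideals do.  By Baire's theorem the functions on X that agree with some a* off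
  a meager set form a tribe on which eta is well defined and sigma-additive, so
  f |-> m (eta (min b* f)) is a sigma-additive functional on M*.  Cutting f into horizontal slices
  of height 1/n shows that such a functional is integration against its values on the sets.
*)
theory Submission
  imports Defs
begin

section \<open>Arithmetic in MV-algebras\<close>

text \<open>Convexity supplies the constants \<open>mv_const r\<close>, the yardstick of the proof.
  Against them an element of a linearly ordered quotient gets a real value, which turns prime ideals
  into states. A lattice state cannot tell \<open>a\<close> from the constant of value
  \<open>\<omega> a\<close>, and so has no proper convex decomposition. The constant functions also
  lie in the tribes, which makes the sets \<open>{f > r}\<close> measurable. The obstacle is that a
  point of the space respects only finite operations: the supremum of an increasing sequence in
  \<open>M\<close> may exceed the pointwise supremum, though only on a meager set. The elements
  \<open>b\<close> are Boolean, so \<open>star b\<close> takes only the values 0 and 1; this is what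
  makes the meet with \<open>star b\<close> additive. A sigma-additive state \<open>s\<close> has to
  be given, since the conclusion itself provides one. Composing it with \<open>\<tau>\<close> makes
  \<open>m\<close> invariant under \<open>\<tau>\<close>, and invariance is what lets
  \<open>\<tau> a\<close> replace \<open>a\<close> under \<open>m\<close>.\<close>

definition mv_diff :: "'a::mv_algebra \<Rightarrow> 'a \<Rightarrow> 'a"  (infixl "\<ominus>" 65)
  where "a \<ominus> b = mv_neg (mv_neg a \<boxplus> b)"

lemma mv_zero_left [simp]: "0 \<boxplus> (a::'a::mv_algebra) = a"
  by (metis mv_commute mv_zero)

lemma mv_neg_zero [simp]: "mv_neg (0::'a::mv_algebra) = 1"
  by (simp add: mv_one)

lemma mv_neg_one [simp]: "mv_neg (1::'a::mv_algebra) = 0"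
  by (metis mv_neg_neg mv_one)

lemma mv_one_left [simp]: "1 \<boxplus> (a::'a::mv_algebra) = 1"
  by (metis mv_commute mv_plus_one)

lemma mv_left_commute: "a \<boxplus> (b \<boxplus> c) = b \<boxplus> (a \<boxplus> (c::'a::mv_algebra))"
  by (metis mv_assoc mv_commute)

lemmas mv_ac = mv_assoc mv_commute mv_left_commute

declare mv_zero [simp] mv_plus_one [simp] mv_neg_neg [simp]

text \<open>Residuation: both sides unfold to \<open>mv_neg a \<boxplus> b \<boxplus> c = 1\<close>.
  So \<open>a \<ominus> b\<close> is the least \<open>c\<close> with
  \<open>a \<le> b \<boxplus> c\<close>, and order arguments can avoid the MV axioms.\<close>

lemma mv_diff_le_iff: "a \<ominus> b \<le> c \<longleftrightarrow> a \<le> b \<boxplus> (c::'a::sigma_mv_algebra)"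
  by (simp add: mv_diff_def mv_le_iff mv_assoc)

lemma mv_zero_le [simp]: "0 \<le> (a::'a::sigma_mv_algebra)"
  by (simp add: mv_le_iff)

lemma mv_le_one [simp]: "(a::'a::sigma_mv_algebra) \<le> 1"
  by (simp add: mv_le_iff)

lemma mv_le_zero_iff [simp]: "(a::'a::sigma_mv_algebra) \<le> 0 \<longleftrightarrow> a = 0"
  by (metis mv_zero_le order_antisym order_refl)

lemma mv_neg_le_iff [simp]: "mv_neg a \<le> mv_neg b \<longleftrightarrow> b \<le> (a::'a::sigma_mv_algebra)"
  by (simp add: mv_le_iff mv_commute)

lemma mv_plus_neg [simp]: "a \<boxplus> mv_neg a = (1::'a::sigma_mv_algebra)"
  using mv_le_iff[of a a] by (simp add: mv_commute)

lemma mv_le_plus [simp]: "a \<le> a \<boxplus> (b::'a::sigma_mv_algebra)"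
  by (metis mv_assoc mv_commute mv_le_iff mv_one_left mv_plus_neg)

lemma mv_le_plus2 [simp]: "b \<le> a \<boxplus> (b::'a::sigma_mv_algebra)"
  by (metis mv_commute mv_le_plus)

lemma mv_le_plus_diff: "a \<le> b \<boxplus> (a \<ominus> (b::'a::sigma_mv_algebra))"
  by (rule iffD1[OF mv_diff_le_iff order_refl])

lemma mv_plus_mono:
  fixes a b c d :: "'a::sigma_mv_algebra"
  assumes "a \<le> c" "b \<le> d"
  shows "a \<boxplus> b \<le> c \<boxplus> d"
proof -
  have *: "z \<boxplus> x \<le> z \<boxplus> y" if "x \<le> y" for x y z :: 'a
  proof -
    have "(z \<boxplus> x) \<ominus> z \<le> x" by (simp add: mv_diff_le_iff)
    with that have "(z \<boxplus> x) \<ominus> z \<le> y" by (rule order_trans[rotated])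
    then show ?thesis by (simp only: mv_diff_le_iff)
  qed
  show ?thesis
    using *[OF assms(1), of b] *[OF assms(2), of c] by (simp add: mv_commute)
qed

lemma orthogonal_mv_iff: "orthogonal_mv a b \<longleftrightarrow> a \<le> mv_neg (b::'a::sigma_mv_algebra)"
  by (metis mv_le_iff mv_neg_neg mv_neg_zero mv_times_def orthogonal_mv_def)

lemma orthogonal_mv_commute: "orthogonal_mv a b \<longleftrightarrow> orthogonal_mv b (a::'a::sigma_mv_algebra)"
  by (metis mv_neg_le_iff mv_neg_neg orthogonal_mv_iff)

lemma mv_diff_le_neg [simp]: "a \<ominus> b \<le> mv_neg (b::'a::sigma_mv_algebra)"
  by (simp add: mv_diff_def)

lemma orthogonal_mv_diff: "orthogonal_mv b (a \<ominus> (b::'a::sigma_mv_algebra))"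
  by (metis mv_diff_le_neg orthogonal_mv_commute orthogonal_mv_iff)

text \<open>The Lukasiewicz axiom makes \<open>b \<boxplus> (a \<ominus> b)\<close> symmetric in
  \<open>a\<close> and \<open>b\<close>. For \<open>s = sup a b\<close> symmetry gives
  \<open>b \<boxplus> (s \<ominus> b) = s\<close>, which bounds the smaller element
  \<open>b \<boxplus> (a \<ominus> b)\<close>.\<close>

lemma mv_plus_diff: "b \<boxplus> (a \<ominus> b) = sup a (b::'a::sigma_mv_algebra)"
proof (rule order_antisym)
  have "b \<boxplus> (a \<ominus> b) = a \<boxplus> (b \<ominus> a)" for a b :: 'a
    using mv_lukasiewicz[of a b] by (simp add: mv_diff_def mv_commute)
  moreover have "b \<boxplus> (a \<ominus> b) \<le> sup a b \<boxplus> (a \<ominus> sup a b)"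
    by (metis calculation mv_diff_def mv_le_iff mv_neg_one mv_zero sup.cobounded1 sup.bounded_iff
        sup_ge2 mv_diff_le_iff mv_le_plus_diff mv_plus_mono order_refl order_trans mv_le_zero_iff)
  moreover have "a \<ominus> sup a b = 0"
    by (simp flip: mv_le_zero_iff add: mv_diff_le_iff del: mv_le_zero_iff)
  ultimately show "b \<boxplus> (a \<ominus> b) \<le> sup a b" by simp
  show "sup a b \<le> b \<boxplus> (a \<ominus> b)" by (simp add: mv_le_plus_diff)
qed

lemma mv_plus_diff_le: "b \<le> a \<Longrightarrow> b \<boxplus> (a \<ominus> b) = (a::'a::sigma_mv_algebra)"
  by (simp add: mv_plus_diff sup_absorb1)

lemma mv_neg_inf: "mv_neg (inf a b) = sup (mv_neg a) (mv_neg (b::'a::sigma_mv_algebra))"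
proof (rule order_antisym)
  have "mv_neg (sup (mv_neg a) (mv_neg b)) \<le> inf a b"
    by (metis inf.boundedI mv_neg_le_iff mv_neg_neg sup_ge1 sup_ge2)
  then show "mv_neg (inf a b) \<le> sup (mv_neg a) (mv_neg b)"
    by (metis mv_neg_le_iff mv_neg_neg)
qed simp

lemma mv_neg_sup: "mv_neg (sup a b) = inf (mv_neg a) (mv_neg (b::'a::sigma_mv_algebra))"
  by (metis mv_neg_inf mv_neg_neg)

text \<open>The negation of \<open>mv_plus_diff\<close>. Subtracting \<open>a\<close> recovers only
  the part of \<open>b\<close> that fits below \<open>mv_neg a\<close>; the rest was lost when the
  sum was truncated at 1.\<close>

lemma mv_plus_diff_cancel: "(a \<boxplus> b) \<ominus> a = inf b (mv_neg (a::'a::sigma_mv_algebra))"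
proof -
  have "mv_neg ((a \<boxplus> b) \<ominus> a) = a \<boxplus> (mv_neg b \<ominus> a)"
    by (simp add: mv_diff_def mv_commute)
  then show ?thesis
    by (metis mv_neg_inf mv_neg_neg mv_plus_diff)
qed

lemma mv_plus_diff_cancel_orthogonal:
  "orthogonal_mv a b \<Longrightarrow> (a \<boxplus> b) \<ominus> a = (b::'a::sigma_mv_algebra)"
  by (metis inf.absorb1 mv_plus_diff_cancel orthogonal_mv_commute orthogonal_mv_iff)

lemma mv_plus_cancel:
  fixes a b c :: "'a::sigma_mv_algebra"
  assumes "orthogonal_mv a b" "orthogonal_mv a c" "a \<boxplus> b = a \<boxplus> c"
  shows "b = c"
  using assms by (metis mv_plus_diff_cancel_orthogonal)

lemma mv_neg_unique:
  fixes a b :: "'a::sigma_mv_algebra"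
  assumes "orthogonal_mv a b" "a \<boxplus> b = 1"
  shows "b = mv_neg a"
  using assms by (metis mv_commute mv_le_iff mv_neg_neg orthogonal_mv_commute orthogonal_mv_iff
      order_antisym)

lemma orthogonal_mv_neg: "orthogonal_mv a (mv_neg (a::'a::sigma_mv_algebra))"
  by (simp add: orthogonal_mv_iff)

text \<open>Every sum is thus an orthogonal sum, so additivity of states and state operators, given
  only for orthogonal pairs, says something about all sums.\<close>

lemma mv_plus_eq_plus_inf: "a \<boxplus> b = a \<boxplus> inf b (mv_neg (a::'a::sigma_mv_algebra))"
  by (metis mv_le_plus mv_plus_diff_cancel mv_plus_diff_le)

lemma orthogonal_mv_inf_neg: "orthogonal_mv a (inf b (mv_neg (a::'a::sigma_mv_algebra)))"
  by (metis inf_le2 orthogonal_mv_commute orthogonal_mv_iff)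

lemma orthogonal_mv_mono:
  "orthogonal_mv a b \<Longrightarrow> c \<le> a \<Longrightarrow> d \<le> b \<Longrightarrow> orthogonal_mv c (d::'a::sigma_mv_algebra)"
  by (meson mv_neg_le_iff order_trans orthogonal_mv_iff)

text \<open>By residuation, adding \<open>a\<close> is an upper adjoint, and upper adjoints preserve
  meets.\<close>

lemma mv_plus_inf: "a \<boxplus> inf b c = inf (a \<boxplus> b) (a \<boxplus> (c::'a::sigma_mv_algebra))"
proof (rule order_antisym)
  show "inf (a \<boxplus> b) (a \<boxplus> c) \<le> a \<boxplus> inf b c"
    by (simp flip: mv_diff_le_iff) (simp add: mv_diff_le_iff)
qed (simp add: mv_plus_mono)

text \<open>Distributing twice writes the right-hand side as a meet of sums. Each of them has
  \<open>c\<close> as a summand, except \<open>b \<boxplus> a\<close>.\<close>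

lemma mv_inf_plus_le: "inf c (a \<boxplus> b) \<le> inf c a \<boxplus> inf c (b::'a::sigma_mv_algebra)"
proof -
  have "inf c a \<boxplus> inf c b = inf (inf c a \<boxplus> c) (inf (b \<boxplus> c) (b \<boxplus> a))"
    by (simp add: mv_plus_inf mv_commute[of "inf c a" b])
  then show ?thesis
    by (simp add: le_infI1 le_infI2 mv_commute)
qed

text \<open>The orthogonal splitting of \<open>a\<close> along \<open>b\<close>, through which
  states and state operators are evaluated on meets and differences. It reduces to
  \<open>mv_plus_diff_le\<close> because subtracting \<open>b\<close> and subtracting
  \<open>inf a b\<close> leave the same upper bounds.\<close>

lemma mv_inf_diff: "inf a b \<boxplus> (a \<ominus> b) = (a::'a::sigma_mv_algebra)"
  and mv_orthogonal_inf_diff: "orthogonal_mv (inf a b) (a \<ominus> (b::'a::sigma_mv_algebra))"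
proof -
  have eq: "a \<ominus> b = a \<ominus> inf a b"
  proof -
    have "a \<ominus> inf a b \<le> x \<longleftrightarrow> a \<ominus> b \<le> x" for x
      by (metis inf.bounded_iff inf_commute mv_commute mv_diff_le_iff mv_le_plus2 mv_plus_inf)
    then show ?thesis by (metis order_antisym order_refl)
  qed
  show "inf a b \<boxplus> (a \<ominus> b) = a" "orthogonal_mv (inf a b) (a \<ominus> b)"
    unfolding eq by (auto simp: mv_plus_diff_le orthogonal_mv_diff)
qed

text \<open>Adding an element below both differences to \<open>inf a b\<close> stays below
  \<open>a\<close> and below \<open>b\<close>, hence adds nothing, and cancellation makes it 0. This
  one identity makes prime quotients linear and extremal states lattice homomorphisms.\<close>

lemma mv_diff_inf_diff: "inf (a \<ominus> b) (b \<ominus> a) = (0::'a::sigma_mv_algebra)"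
proof -
  let ?c = "inf a b" and ?d = "inf (a \<ominus> b) (b \<ominus> a)"
  have "?c \<boxplus> ?d \<le> a" "?c \<boxplus> ?d \<le> b"
    by (metis inf_le1 mv_inf_diff mv_plus_mono order_refl)
       (metis inf_commute inf_le2 mv_inf_diff mv_plus_mono order_refl)
  then have "?c \<boxplus> ?d = ?c \<boxplus> 0"
    by (simp add: order_antisym)
  moreover have "orthogonal_mv ?c ?d"
    using mv_orthogonal_inf_diff orthogonal_mv_mono by (metis inf_le1 order_refl)
  ultimately show ?thesis
    by (metis mv_plus_cancel mv_zero_le orthogonal_mv_iff mv_neg_zero mv_le_one)
qed

lemma mv_diff_eq_zero_iff: "a \<ominus> b = 0 \<longleftrightarrow> a \<le> (b::'a::sigma_mv_algebra)"
  by (metis mv_diff_le_iff mv_le_zero_iff mv_zero)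

section \<open>Finite multiples of an element\<close>

primrec mv_mult :: "nat \<Rightarrow> 'a::mv_algebra \<Rightarrow> 'a" where
  "mv_mult 0 a = 0"
| "mv_mult (Suc n) a = a \<boxplus> mv_mult n a"

lemma mv_mult_add: "mv_mult (m + n) a = mv_mult m a \<boxplus> mv_mult n a"
  by (induction m) (auto simp: mv_assoc)

lemma mv_mult_mono: "m \<le> n \<Longrightarrow> mv_mult m a \<le> mv_mult n (a::'a::sigma_mv_algebra)"
  by (metis le_Suc_ex mv_le_plus mv_mult_add)

lemma mv_inf_mult_eq_zero:
  fixes a b :: "'a::sigma_mv_algebra"
  assumes "inf a b = 0"
  shows "inf a (mv_mult n b) = 0"
proof (induction n)
  case (Suc n)
  then show ?case
    using mv_inf_plus_le[of a b "mv_mult n b"] assms by simp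
qed (simp add: inf.absorb2)

section \<open>Constants\<close>

abbreviation mv_const :: "real \<Rightarrow> 'a::convex_mv_algebra"
  where "mv_const r \<equiv> mv_scale r 1"

lemma mv_const_add:
  "0 \<le> r \<Longrightarrow> 0 \<le> s \<Longrightarrow> r + s \<le> 1 \<Longrightarrow>
    mv_const (r + s) = mv_const r \<boxplus> (mv_const s :: 'a::convex_mv_algebra)"
  by (simp add: mv_scale_add_left)

lemma mv_const_neg:
  assumes "r \<in> {0..1}"
  shows "mv_neg (mv_const r) = (mv_const (1 - r) :: 'a::convex_sigma_mv_algebra)"
  using assms mv_scale_add_left[of r "1 - r" "1::'a"]
  by (metis add.commute diff_add_cancel mv_neg_unique mv_scale_one atLeastAtMost_iff
      diff_ge_0_iff_ge diff_le_eq le_add_same_cancel1 order_refl add_increasing2)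

lemma mv_const_zero [simp]: "mv_const 0 = (0 :: 'a::convex_sigma_mv_algebra)"
  using mv_const_neg[of 1, where 'a='a] by (simp add: mv_scale_one)

lemma mv_const_mono:
  assumes "0 \<le> r" "r \<le> s" "s \<le> 1"
  shows "mv_const r \<le> (mv_const s :: 'a::convex_sigma_mv_algebra)"
  using mv_const_add[of r "s - r", where 'a='a] assms by simp

lemma mv_const_diff:
  assumes "0 \<le> s" "s \<le> r" "r \<le> 1"
  shows "mv_const r \<ominus> mv_const s = (mv_const (r - s) :: 'a::convex_sigma_mv_algebra)"
  using mv_scale_add_left[of s "r - s" "1::'a"] assms mv_plus_diff_cancel_orthogonal by fastforce

text \<open>The infimum \<open>w\<close> of the constants exists by countable completeness. Its
  double is again a lower bound, so \<open>w \<boxplus> w = w\<close>, and an element that is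
  orthogonal to itself cancels from this equation.\<close>

lemma mv_archimedean:
  fixes x :: "'a::convex_sigma_mv_algebra"
  assumes "\<And>n::nat. x \<le> mv_const (1 / real (Suc n))"
  shows "x = 0"
proof -
  define c :: "nat \<Rightarrow> 'a" where "c n = mv_const (1 / real (Suc n))" for n
  define w where "w = Inf (range c)"
  have w_le: "w \<le> c n" for n
    unfolding w_def by (intro ccInf_lower) auto
  have le_w: "z \<le> w" if "\<And>n. z \<le> c n" for z
    unfolding w_def using that by (intro ccInf_greatest) auto
  have "x \<le> w"
    using assms by (intro le_w) (simp only: c_def)
  have "w \<boxplus> w \<le> c n" for n
  proof -
    \<comment> \<open>The index \<open>2 * n + 1\<close> belongs to the constant with half the value
      of \<open>c n\<close>.\<close>
    have "w \<boxplus> w \<le> c (2 * n + 1) \<boxplus> c (2 * n + 1)"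
      by (intro mv_plus_mono w_le)
    also have "\<dots> = c n"
    proof -
      have "1 / real (Suc n) = 1 / real (Suc (2 * n + 1)) + 1 / real (Suc (2 * n + 1))"
        by (simp add: field_simps)
      then show ?thesis
        unfolding c_def by (simp only:) (rule mv_const_add[symmetric], auto simp: field_simps)
    qed
    finally show ?thesis .
  qed
  then have "w \<boxplus> w \<le> w"
    by (rule le_w)
  then have "w \<boxplus> w = w \<boxplus> 0"
    by (simp add: order_antisym)
  moreover have "orthogonal_mv w w"
  proof -
    have "w \<le> c 1" by (rule w_le)
    \<comment> \<open>\<open>c 1\<close> is the constant 1/2, its own complement; whatever lies
      below it is orthogonal to itself.\<close>
    moreover have "mv_neg (c 1) = c 1"
      by (simp add: c_def mv_const_neg)
    ultimately show ?thesis
      by (metis mv_neg_le_iff order_trans orthogonal_mv_iff)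
  qed
  moreover have "orthogonal_mv w 0"
    by (simp add: orthogonal_mv_iff)
  ultimately have "w = 0"
    using mv_plus_cancel by metis
  with \<open>x \<le> w\<close> show ?thesis by simp
qed

section \<open>States\<close>

text \<open>Cauchy's functional equation on the unit interval: nonnegativity makes \<open>f\<close>
  monotone, and the rationals, where \<open>f\<close> is linear, squeeze it elsewhere.\<close>

lemma additive_unit_interval_linear:
  fixes f :: "real \<Rightarrow> real"
  assumes add: "\<And>r s. 0 \<le> r \<Longrightarrow> 0 \<le> s \<Longrightarrow> r + s \<le> 1 \<Longrightarrow> f (r + s) = f r + f s"
    and nonneg: "\<And>r. 0 \<le> r \<Longrightarrow> r \<le> 1 \<Longrightarrow> 0 \<le> f r"
    and r: "r \<in> {0..1}"
  shows "f r = r * f 1"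
\<comment> \<open>For \<open>r < 1\<close> the upper neighbour
  \<open>real (Suc k) / real (Suc n)\<close> of \<open>r\<close> chosen below still lies in the
  domain.\<close>
proof (cases "r = 1")
  case False
  with r have r0: "0 \<le> r" "r < 1" by auto
  have f0: "f 0 = 0" using add[of 0 0] by simp
  have mono: "f s \<le> f t" if "0 \<le> s" "s \<le> t" "t \<le> 1" for s t
    using add[of s "t - s"] nonneg[of "t - s"] that by simp
  have mult: "f (real k / real n) = real k * f (1 / real n)" if "k \<le> n" "0 < n" for k n :: nat
    using that(1)
  proof (induction k)
    case (Suc k)
    have "f (real (Suc k) / real n) = f (real k / real n + 1 / real n)"
      by (simp add: add_divide_distrib add.commute)
    also have "\<dots> = f (real k / real n) + f (1 / real n)"
      using Suc.prems that(2) by (intro add) (auto simp: field_simps)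
    finally show ?case using Suc by (simp add: algebra_simps)
  qed (simp add: f0)
  have frac: "f (real k / real n) = real k / real n * f 1" if "k \<le> n" "0 < n" for k n :: nat
    using mult[OF that] mult[of n n] that by simp
  have bound: "\<bar>f r - r * f 1\<bar> \<le> f 1 / real (Suc n)" for n
  proof -
    define k where "k = nat \<lfloor>r * real (Suc n)\<rfloor>"
    have k: "real k \<le> r * real (Suc n)" "r * real (Suc n) < real k + 1"
      unfolding k_def using r0 by auto
    have "r * real (Suc n) < real (Suc n)" using r0 by simp
    with k have kn: "k < Suc n" by linarith
    have lo: "real k / real (Suc n) \<le> r" and hi: "r \<le> real (Suc k) / real (Suc n)"
      using k by (auto simp: field_simps)
    have "f r \<ge> real k / real (Suc n) * f 1"
      using mono[OF _ lo] frac[of k "Suc n"] kn r0 by simp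
    moreover have "f r \<le> real (Suc k) / real (Suc n) * f 1"
      using mono[OF _ hi] frac[of "Suc k" "Suc n"] kn r0 by simp
    moreover have "real k / real (Suc n) * f 1 \<le> r * f 1" "r * f 1 \<le> real (Suc k) / real (Suc n) * f 1"
      using mult_right_mono[OF lo nonneg[of 1]] mult_right_mono[OF hi nonneg[of 1]] by simp_all
    moreover have "real (Suc k) / real (Suc n) * f 1 = real k / real (Suc n) * f 1 + f 1 / real (Suc n)"
      by (simp add: add_divide_distrib distrib_right)
    ultimately show ?thesis by linarith
  qed
  have "(\<lambda>n. f 1 / real (Suc n)) \<longlonglongrightarrow> 0"
    using LIMSEQ_Suc[OF lim_const_over_n[of "f 1"]] by simp
  then have "\<bar>f r - r * f 1\<bar> \<le> 0"
    by (rule LIMSEQ_le_const) (use bound in auto)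
  then show ?thesis by simp
qed simp

lemma mv_state_add: "mv_state m \<Longrightarrow> orthogonal_mv a b \<Longrightarrow> m (a \<boxplus> b) = m a + m b"
  and mv_state_one: "mv_state m \<Longrightarrow> m 1 = 1"
  and mv_state_nonneg: "mv_state m \<Longrightarrow> 0 \<le> m a"
  and mv_state_le_one: "mv_state m \<Longrightarrow> m a \<le> 1"
  by (auto simp: mv_state_def)

lemma mv_state_zero: "mv_state m \<Longrightarrow> m (0::'a::sigma_mv_algebra) = 0"
  using mv_state_add[of m 0 0] by (simp add: orthogonal_mv_iff)

lemma mv_state_mono:
  fixes a b :: "'a::sigma_mv_algebra"
  assumes "mv_state m" "a \<le> b"
  shows "m a \<le> m b"
  using mv_state_add[OF assms(1) orthogonal_mv_diff, of a b] mv_plus_diff_le[OF assms(2)]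
    mv_state_nonneg[OF assms(1), of "b \<ominus> a"] by simp

lemma mv_state_neg: "mv_state m \<Longrightarrow> m (mv_neg (a::'a::sigma_mv_algebra)) = 1 - m a"
  using mv_state_add[of m a "mv_neg a"] by (simp add: mv_state_one orthogonal_mv_neg)

lemma mv_state_inf_diff:
  "mv_state m \<Longrightarrow> m (a::'a::sigma_mv_algebra) = m (inf a b) + m (a \<ominus> b)"
  using mv_state_add[of m "inf a b" "a \<ominus> b"] by (simp add: mv_inf_diff mv_orthogonal_inf_diff)

lemma mv_state_scale:
  fixes m :: "'a::convex_mv_algebra \<Rightarrow> real"
  assumes "mv_state m" "r \<in> {0..1}"
  shows "m (mv_scale r a) = r * m a"
proof -
  have "m (mv_scale r a) = r * m (mv_scale 1 a)"
    using assms
    by (intro additive_unit_interval_linear)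
       (auto simp: mv_state_nonneg mv_scale_add_left mv_state_add)
  then show ?thesis by (simp add: mv_scale_one)
qed

lemma mv_state_const:
  fixes m :: "'a::convex_mv_algebra \<Rightarrow> real"
  shows "mv_state m \<Longrightarrow> r \<in> {0..1} \<Longrightarrow> m (mv_const r) = r"
  by (simp add: mv_state_scale mv_state_one)

text \<open>These are the MV-homomorphisms into the unit interval: since every sum is an orthogonal
  sum with a meet, preserving meets forces the truncated sum in
  \<open>lattice_state_plus\<close>.\<close>

definition lattice_state :: "('a::sigma_mv_algebra \<Rightarrow> real) \<Rightarrow> bool"
  where "lattice_state \<omega> \<longleftrightarrow> mv_state \<omega> \<and> (\<forall>a b. \<omega> (inf a b) = min (\<omega> a) (\<omega> b))"

lemma lattice_state_mv_state: "lattice_state \<omega> \<Longrightarrow> mv_state \<omega>"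
  and lattice_state_inf: "lattice_state \<omega> \<Longrightarrow> \<omega> (inf a b) = min (\<omega> a) (\<omega> b)"
  by (auto simp: lattice_state_def)

lemma lattice_state_diff: "lattice_state \<omega> \<Longrightarrow> \<omega> (a \<ominus> b) = max 0 (\<omega> a - \<omega> b)"
  using mv_state_inf_diff[OF lattice_state_mv_state, of \<omega> a b] lattice_state_inf[of \<omega> a b] by linarith

lemma lattice_state_plus: "lattice_state \<omega> \<Longrightarrow> \<omega> (a \<boxplus> b) = min 1 (\<omega> a + \<omega> b)"
  using mv_state_add[of \<omega> a "inf b (mv_neg a)"] mv_plus_eq_plus_inf[of a b]
    orthogonal_mv_inf_neg[of a b]
  by (auto simp: lattice_state_def mv_state_neg min_def)

text \<open>A component \<open>m1\<close> of \<open>\<omega>\<close> vanishes wherever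
  \<open>\<omega>\<close> does. With \<open>r = \<omega> a\<close>, both differences between
  \<open>a\<close> and \<open>mv_const r\<close> are null for \<open>\<omega>\<close>, so
  \<open>m1\<close> has the same value on \<open>a\<close> as on this constant, where all states
  agree.\<close>

lemma lattice_state_extremal:
  fixes \<omega> :: "'a::convex_sigma_mv_algebra \<Rightarrow> real"
  assumes "lattice_state \<omega>"
  shows "extremal_state \<omega>"
proof -
  have main: "m1 = \<omega>"
    if m: "mv_state m1" "mv_state m2" and t: "0 < t" "t < 1"
      and eq: "\<omega> = (\<lambda>a. t * m1 a + (1 - t) * m2 a)" for m1 m2 :: "'a \<Rightarrow> real" and t
  proof
    fix a
    have null: "m1 c = 0" if "\<omega> c = 0" for c
    proof -
      have "t * m1 c + (1 - t) * m2 c = 0" using that eq by metis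
      moreover have "0 \<le> t * m1 c" "0 \<le> (1 - t) * m2 c"
        using t m by (simp_all add: mv_state_nonneg)
      ultimately have "t * m1 c = 0" by linarith
      with t show ?thesis by simp
    qed
    define r where "r = \<omega> a"
    have r: "r \<in> {0..1}"
      using lattice_state_mv_state[OF assms] by (simp add: r_def mv_state_nonneg mv_state_le_one)
    have wr: "\<omega> (mv_const r) = r"
      using mv_state_const[OF lattice_state_mv_state[OF assms] r] .
    have "m1 (a \<ominus> mv_const r) = 0" "m1 (mv_const r \<ominus> a) = 0"
      by (auto intro!: null simp: lattice_state_diff[OF assms] wr) (auto simp: r_def)
    then have "m1 a = m1 (mv_const r)"
      using mv_state_inf_diff[OF m(1), of a "mv_const r"]
        mv_state_inf_diff[OF m(1), of "mv_const r" a] by (simp add: inf_commute)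
    then show "m1 a = \<omega> a"
      using mv_state_const[OF m(1) r] by (simp add: r_def)
  qed
  show ?thesis
    unfolding extremal_state_def
  proof (intro conjI allI impI)
    show "mv_state \<omega>" using assms by (rule lattice_state_mv_state)
    fix m1 m2 :: "'a \<Rightarrow> real" and t :: real
    assume *: "mv_state m1" "mv_state m2" "0 < t" "t < 1" "\<omega> = (\<lambda>a. t * m1 a + (1 - t) * m2 a)"
    show "m1 = \<omega>" using main[OF *] .
    have "\<omega> = (\<lambda>a. (1 - t) * m2 a + (1 - (1 - t)) * m1 a)"
      by (subst *(5)) (simp add: add.commute)
    then show "m2 = \<omega>" using main[of m2 m1 "1 - t"] * by simp
  qed
qed

text \<open>Normalising \<open>p\<close> and its remainder in \<open>\<omega>\<close> gives two
  states of which \<open>\<omega>\<close> is a convex combination with weight \<open>p 1\<close>, so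
  extremality identifies them with \<open>\<omega>\<close>.\<close>

lemma extremal_state_dominated:
  fixes \<omega> p :: "'a::sigma_mv_algebra \<Rightarrow> real"
  assumes ext: "extremal_state \<omega>"
    and add: "\<And>x y. orthogonal_mv x y \<Longrightarrow> p (x \<boxplus> y) = p x + p y"
    and p: "\<And>x. 0 \<le> p x" "\<And>x. p x \<le> \<omega> x"
  shows "p x = p 1 * \<omega> x"
proof -
  have st: "mv_state \<omega>" using ext by (simp add: extremal_state_def)
  have le1: "p 1 \<le> 1" using p(2)[of 1] st by (simp add: mv_state_one)
  have bound: "q x \<le> q 1"
    if "\<And>x y. orthogonal_mv x y \<Longrightarrow> q (x \<boxplus> y) = q x + q y" "\<And>x. 0 \<le> q x"
    for q :: "'a \<Rightarrow> real" and x
    using that(1)[OF orthogonal_mv_neg[of x]] that(2)[of "mv_neg x"] by simp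
  have add': "\<omega> (x \<boxplus> y) - p (x \<boxplus> y) = (\<omega> x - p x) + (\<omega> y - p y)" if "orthogonal_mv x y" for x y
    using that st by (simp add: add mv_state_add)
  have pb: "p x \<le> p 1" for x by (rule bound) (auto simp: add p)
  have pb': "\<omega> x - p x \<le> 1 - p 1" for x
    using bound[of "\<lambda>x. \<omega> x - p x"] add' p st by (simp add: mv_state_one)
  \<comment> \<open>If \<open>p 1\<close> is 0 or 1, one of the two parts has total mass 0. It
    cannot be normalised, but it vanishes.\<close>
  consider "p 1 = 0" | "p 1 = 1" | "0 < p 1" "p 1 < 1"
    using le1 p(1)[of 1] by linarith
  then show ?thesis
  proof cases
    case 1
    then show ?thesis using pb[of x] p(1)[of x] by simp
  next
    case 2
    then show ?thesis using pb'[of x] p(2)[of x] by simp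
  next
    case 3
    define m1 m2 where "m1 = (\<lambda>x. p x / p 1)" and "m2 = (\<lambda>x. (\<omega> x - p x) / (1 - p 1))"
    have "mv_state m1"
      unfolding mv_state_def m1_def using 3 p pb by (auto simp: add add_divide_distrib)
    moreover have "mv_state m2"
      unfolding mv_state_def m2_def using 3 p pb' st add'
      by (auto simp: mv_state_one simp flip: add_divide_distrib)
    moreover have "\<omega> = (\<lambda>a. p 1 * m1 a + (1 - p 1) * m2 a)"
      unfolding m1_def m2_def using 3 by auto
    ultimately have "m1 = \<omega>"
      using ext 3 unfolding extremal_state_def by blast
    then have "m1 x = \<omega> x" by simp
    with 3 show ?thesis by (simp add: m1_def field_simps)
  qed
qed

lemma extremal_state_disjoint:
  fixes \<omega> :: "'a::sigma_mv_algebra \<Rightarrow> real"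
  assumes ext: "extremal_state \<omega>" and ab: "inf a b = 0"
  shows "\<omega> a = 0 \<or> \<omega> b = 0"
proof -
  have st: "mv_state \<omega>" using ext by (simp add: extremal_state_def)
  \<comment> \<open>The component of \<open>\<omega>\<close> carried by the band generated by \<open>a\<close>.\<close>
  define p where "p x = (SUP n. \<omega> (inf x (mv_mult n a)))" for x
  have bdd: "bdd_above (range (\<lambda>n. \<omega> (inf x (mv_mult n a))))" for x
    using mv_state_le_one[OF st] by (auto intro!: bdd_aboveI[of _ 1])
  have mono: "incseq (\<lambda>n. \<omega> (inf x (mv_mult n a)))" for x
    by (intro monoI mv_state_mono[OF st] inf_mono mv_mult_mono) auto
  have lim: "(\<lambda>n. \<omega> (inf x (mv_mult n a))) \<longlonglongrightarrow> p x" for x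
    unfolding p_def by (rule LIMSEQ_incseq_SUP[OF bdd mono])
  have le_p: "\<omega> (inf x (mv_mult n a)) \<le> p x" for x n
    unfolding p_def by (rule cSUP_upper[OF _ bdd]) simp
  have p_le: "p x \<le> \<omega> x" for x
    unfolding p_def by (intro cSUP_least mv_state_mono[OF st]) auto
  have p_nonneg: "0 \<le> p x" for x
    using le_p[of x 0] mv_state_nonneg[OF st] order_trans by blast
  have p_add: "p (x \<boxplus> y) = p x + p y" if o: "orthogonal_mv x y" for x y
  proof (rule order_antisym)
    have sum: "\<omega> (inf x c \<boxplus> inf y d) = \<omega> (inf x c) + \<omega> (inf y d)" for c d
      by (intro mv_state_add[OF st] orthogonal_mv_mono[OF o]) auto
    have "\<omega> (inf (x \<boxplus> y) (mv_mult n a)) \<le> \<omega> (inf x (mv_mult n a)) + \<omega> (inf y (mv_mult n a))" for n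
      unfolding sum[symmetric]
      using mv_inf_plus_le[of "mv_mult n a" x y] by (intro mv_state_mono[OF st]) (simp add: inf_commute)
    then show "p (x \<boxplus> y) \<le> p x + p y"
      by (intro LIMSEQ_le[OF lim tendsto_add[OF lim lim]]) auto
    \<comment> \<open>Each of the two meets may use up \<open>n\<close> copies of \<open>a\<close>,
      hence the \<open>n + n\<close> copies for their sum.\<close>
    have "\<omega> (inf x (mv_mult n a)) + \<omega> (inf y (mv_mult n a)) \<le> p (x \<boxplus> y)" for n
    proof -
      have "inf x (mv_mult n a) \<boxplus> inf y (mv_mult n a) \<le> inf (x \<boxplus> y) (mv_mult (n + n) a)"
        unfolding mv_mult_add by (intro le_infI mv_plus_mono) auto
      then show ?thesis
        unfolding sum[symmetric] by (meson le_p mv_state_mono[OF st] order_trans)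
    qed
    then show "p x + p y \<le> p (x \<boxplus> y)"
      by (intro LIMSEQ_le_const2[OF tendsto_add[OF lim lim]]) auto
  qed
  have eq: "p x = p 1 * \<omega> x" for x
    by (rule extremal_state_dominated[OF ext]) (auto intro: p_add p_nonneg p_le)
  have "p a = \<omega> a"
    using le_p[of a 1] p_le[of a] by simp
  moreover have "p b = 0"
    using mv_inf_mult_eq_zero[of b a] ab by (simp add: p_def inf_commute mv_state_zero[OF st])
  \<comment> \<open>\<open>\<omega> b\<close> can be nonzero only if \<open>p 1 = 0\<close>, and
    then \<open>\<omega> a = p a\<close> vanishes.\<close>
  ultimately show ?thesis
    using eq[of a] eq[of b] by auto
qed

text \<open>The two differences of \<open>a\<close> and \<open>b\<close> are disjoint, so an
  extremal state annihilates one of them. Its value at \<open>inf a b\<close> is then its value at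
  \<open>a\<close> or at \<open>b\<close>.\<close>

lemma extremal_state_iff_lattice_state:
  "extremal_state \<omega> \<longleftrightarrow> lattice_state (\<omega> :: 'a::convex_sigma_mv_algebra \<Rightarrow> real)"
proof
  assume ext: "extremal_state \<omega>"
  then have st: "mv_state \<omega>" by (simp add: extremal_state_def)
  have "\<omega> (inf a b) = min (\<omega> a) (\<omega> b)" for a b
    using extremal_state_disjoint[OF ext mv_diff_inf_diff, of a b]
      mv_state_inf_diff[OF st, of a b] mv_state_inf_diff[OF st, of b a]
      mv_state_nonneg[OF st, of "a \<ominus> b"] mv_state_nonneg[OF st, of "b \<ominus> a"]
    by (auto simp: inf_commute)
  with st show "lattice_state \<omega>" by (simp add: lattice_state_def)
qed (rule lattice_state_extremal)

section \<open>Lattice states separate points\<close>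

definition mv_ideal :: "'a::sigma_mv_algebra set \<Rightarrow> bool"
  where "mv_ideal I \<longleftrightarrow>
    0 \<in> I \<and> (\<forall>a\<in>I. \<forall>b\<in>I. a \<boxplus> b \<in> I) \<and> (\<forall>a\<in>I. \<forall>b\<le>a. b \<in> I)"

lemma mv_ideal_zero: "mv_ideal I \<Longrightarrow> 0 \<in> I"
  and mv_ideal_plus: "mv_ideal I \<Longrightarrow> a \<in> I \<Longrightarrow> b \<in> I \<Longrightarrow> a \<boxplus> b \<in> I"
  and mv_ideal_down: "mv_ideal I \<Longrightarrow> a \<in> I \<Longrightarrow> b \<le> a \<Longrightarrow> b \<in> I"
  by (auto simp: mv_ideal_def)

lemma mv_ideal_mult: "mv_ideal I \<Longrightarrow> a \<in> I \<Longrightarrow> mv_mult n a \<in> I"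
  by (induction n) (auto simp: mv_ideal_zero mv_ideal_plus)

text \<open>The set is the ideal generated by \<open>I\<close> and \<open>a\<close>; it competes
  with a maximal ideal in \<open>prime_ideal_avoiding\<close>.\<close>

lemma mv_ideal_extend:
  fixes I :: "'a::sigma_mv_algebra set"
  assumes I: "mv_ideal I"
  shows "mv_ideal {z. \<exists>p\<in>I. \<exists>n. z \<le> p \<boxplus> mv_mult n a}" (is "mv_ideal ?J")
  unfolding mv_ideal_def
proof (intro conjI ballI allI impI)
  show "0 \<in> ?J" using mv_ideal_zero[OF I] by auto
next
  fix x y assume "x \<in> ?J" "y \<in> ?J"
  then obtain p q m n where *: "p \<in> I" "q \<in> I" "x \<le> p \<boxplus> mv_mult m a" "y \<le> q \<boxplus> mv_mult n a"
    by auto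
  then have "x \<boxplus> y \<le> (p \<boxplus> mv_mult m a) \<boxplus> (q \<boxplus> mv_mult n a)"
    by (intro mv_plus_mono)
  also have "\<dots> = (p \<boxplus> q) \<boxplus> mv_mult (m + n) a"
    by (simp only: mv_mult_add mv_ac)
  finally show "x \<boxplus> y \<in> ?J" using mv_ideal_plus[OF I *(1,2)] by blast
next
  fix x y assume "x \<in> ?J" "y \<le> x"
  then show "y \<in> ?J" using order_trans by blast
qed

text \<open>An ideal maximal among those missing \<open>y\<close> is prime. If it missed both
  \<open>a\<close> and \<open>b\<close>, then \<open>y\<close> would lie below
  \<open>p \<boxplus> q\<close> plus a multiple of \<open>a\<close>, and below the same plus a
  multiple of \<open>b\<close>. These multiples are disjoint, so
  \<open>y \<le> p \<boxplus> q\<close> would belong to the ideal.\<close>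

lemma prime_ideal_avoiding:
  fixes y :: "'a::sigma_mv_algebra"
  assumes "y \<noteq> 0"
  obtains P where "mv_ideal P" "y \<notin> P" "\<And>a b. inf a b = 0 \<Longrightarrow> a \<in> P \<or> b \<in> P"
proof -
  let ?\<A> = "{I. mv_ideal I \<and> y \<notin> I}"
  have "\<exists>P\<in>?\<A>. \<forall>X\<in>?\<A>. P \<subseteq> X \<longrightarrow> X = P"
  proof (rule subset_Zorn_nonempty)
    show "?\<A> \<noteq> {}"
      using assms by (auto simp: mv_ideal_def intro!: exI[of _ "{0}"])
  next
    fix \<C> assume "\<C> \<noteq> {}" and chain: "subset.chain ?\<A> \<C>"
    then have *: "\<And>I. I \<in> \<C> \<Longrightarrow> mv_ideal I" "y \<notin> \<Union>\<C>"
      and lin: "\<And>I J. I \<in> \<C> \<Longrightarrow> J \<in> \<C> \<Longrightarrow> I \<subseteq> J \<or> J \<subseteq> I"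
      by (auto simp: subset_chain_def)
    have "mv_ideal (\<Union>\<C>)"
      unfolding mv_ideal_def
    proof (intro conjI ballI allI impI)
      show "0 \<in> \<Union>\<C>" using \<open>\<C> \<noteq> {}\<close> *(1) mv_ideal_zero by blast
    next
      fix a b assume "a \<in> \<Union>\<C>" "b \<in> \<Union>\<C>"
      then obtain I J where "I \<in> \<C>" "J \<in> \<C>" "a \<in> I" "b \<in> J" by blast
      then show "a \<boxplus> b \<in> \<Union>\<C>"
        using lin[of I J] *(1) mv_ideal_plus by blast
    next
      fix a b assume "a \<in> \<Union>\<C>" "b \<le> a"
      then show "b \<in> \<Union>\<C>" using *(1) mv_ideal_down by blast
    qed
    with * show "\<Union>\<C> \<in> ?\<A>" by simp
  qed
  then obtain P where P: "mv_ideal P" "y \<notin> P"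
    and max: "\<And>X. mv_ideal X \<Longrightarrow> y \<notin> X \<Longrightarrow> P \<subseteq> X \<Longrightarrow> X = P"
    by auto
  have ext: "\<exists>p\<in>P. \<exists>n. y \<le> p \<boxplus> mv_mult n a" if "a \<notin> P" for a
  proof (rule ccontr)
    assume neg: "\<not> ?thesis"
    let ?J = "{z. \<exists>p\<in>P. \<exists>n. z \<le> p \<boxplus> mv_mult n a}"
    have "P \<subseteq> ?J" using mv_le_plus by blast
    moreover have "a \<in> ?J"
      using mv_ideal_zero[OF P(1)] by (auto intro!: bexI[of _ 0] exI[of _ 1])
    ultimately show False
      using max[OF mv_ideal_extend[OF P(1)], of a] neg that by blast
  qed
  have "a \<in> P \<or> b \<in> P" if ab: "inf a b = 0" for a b
  proof (rule ccontr)
    assume "\<not> ?thesis"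
    then obtain p q m n where *: "p \<in> P" "q \<in> P" "y \<le> p \<boxplus> mv_mult m a" "y \<le> q \<boxplus> mv_mult n b"
      using ext[of a] ext[of b] by blast
    have "y \<le> (p \<boxplus> q) \<boxplus> mv_mult m a" "y \<le> (p \<boxplus> q) \<boxplus> mv_mult n b"
      by (meson *(3,4) mv_le_plus mv_le_plus2 mv_plus_mono order_refl order_trans)+
    then have "y \<le> (p \<boxplus> q) \<boxplus> inf (mv_mult m a) (mv_mult n b)"
      by (simp add: mv_plus_inf)
    also have "inf (mv_mult m a) (mv_mult n b) = 0"
      using mv_inf_mult_eq_zero[OF ab, of n] mv_inf_mult_eq_zero[of "mv_mult n b" a m]
      by (simp add: inf_commute)
    finally show False
      using P(2) mv_ideal_down[OF P(1) mv_ideal_plus[OF P(1) *(1,2)]] by simp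
  qed
  with P that show thesis by blast
qed

text \<open>Primeness is asked of disjoint pairs; applied to \<open>a \<ominus> b\<close> and
  \<open>b \<ominus> a\<close> it makes the quotient linearly ordered.\<close>

locale prime_ideal =
  fixes P :: "'a::convex_sigma_mv_algebra set"
  assumes ideal: "mv_ideal P" and one_notin: "1 \<notin> P"
    and prime: "\<And>a b. inf a b = 0 \<Longrightarrow> a \<in> P \<or> b \<in> P"
begin

text \<open>The order of the quotient by \<open>P\<close>, pulled back to the algebra so that no
  quotient has to be formed.\<close>

definition le_mod :: "'a \<Rightarrow> 'a \<Rightarrow> bool"  (infix "\<preceq>" 50)
  where "a \<preceq> b \<longleftrightarrow> a \<ominus> b \<in> P"

lemma le_modI: "a \<le> b \<Longrightarrow> a \<preceq> b"
  by (simp add: le_mod_def mv_ideal_zero[OF ideal] flip: mv_diff_eq_zero_iff)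

lemma le_mod_linear: "a \<preceq> b \<or> b \<preceq> a"
  unfolding le_mod_def by (rule prime[OF mv_diff_inf_diff])

lemma le_mod_trans:
  assumes "a \<preceq> b" "b \<preceq> c" shows "a \<preceq> c"
proof -
  have "a \<le> b \<boxplus> (a \<ominus> b)" "b \<le> c \<boxplus> (b \<ominus> c)" by (rule mv_le_plus_diff)+
  then have "a \<le> c \<boxplus> (b \<ominus> c) \<boxplus> (a \<ominus> b)"
    by (meson mv_plus_mono order_refl order_trans)
  then have "a \<ominus> c \<le> (b \<ominus> c) \<boxplus> (a \<ominus> b)"
    by (simp add: mv_diff_le_iff mv_assoc)
  with assms show ?thesis
    unfolding le_mod_def using mv_ideal_down[OF ideal] mv_ideal_plus[OF ideal] by blast
qed

lemma le_mod_plus: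
  assumes "a \<preceq> b" "c \<preceq> d" shows "a \<boxplus> c \<preceq> b \<boxplus> d"
proof -
  have "a \<boxplus> c \<le> (b \<boxplus> (a \<ominus> b)) \<boxplus> (d \<boxplus> (c \<ominus> d))"
    by (intro mv_plus_mono mv_le_plus_diff)
  then have "(a \<boxplus> c) \<ominus> (b \<boxplus> d) \<le> (a \<ominus> b) \<boxplus> (c \<ominus> d)"
    by (simp add: mv_diff_le_iff mv_ac)
  with assms show ?thesis
    unfolding le_mod_def using mv_ideal_down[OF ideal] mv_ideal_plus[OF ideal] by blast
qed

lemma le_mod_neg: "mv_neg a \<preceq> mv_neg b \<longleftrightarrow> b \<preceq> a"
  by (simp add: le_mod_def mv_diff_def mv_commute)

lemma le_mod_inf: "c \<preceq> inf a b \<longleftrightarrow> c \<preceq> a \<and> c \<preceq> b"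
proof
  assume "c \<preceq> inf a b"
  then show "c \<preceq> a \<and> c \<preceq> b"
    using le_mod_trans le_modI by (meson inf_le1 inf_le2)
next
  assume *: "c \<preceq> a \<and> c \<preceq> b"
  have "c \<le> inf (a \<boxplus> ((c \<ominus> a) \<boxplus> (c \<ominus> b))) (b \<boxplus> ((c \<ominus> a) \<boxplus> (c \<ominus> b)))"
    by (metis inf.boundedI mv_diff_le_iff mv_le_plus mv_le_plus2)
  also have "\<dots> = inf a b \<boxplus> ((c \<ominus> a) \<boxplus> (c \<ominus> b))"
    using mv_plus_inf[of "(c \<ominus> a) \<boxplus> (c \<ominus> b)" a b] by (simp only: mv_commute)
  finally have "c \<ominus> inf a b \<le> (c \<ominus> a) \<boxplus> (c \<ominus> b)"
    by (simp add: mv_diff_le_iff)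
  with * show "c \<preceq> inf a b"
    unfolding le_mod_def using mv_ideal_down[OF ideal] mv_ideal_plus[OF ideal] by blast
qed

lemma mv_mult_const:
  "0 \<le> r \<Longrightarrow> real n * r \<le> 1 \<Longrightarrow> mv_mult n (mv_const r) = (mv_const (real n * r) :: 'a)"
proof (induction n)
  case (Suc n)
  have "real n * r \<le> 1" using Suc.prems by (simp add: algebra_simps)
  with Suc show ?case
    using mv_const_add[of r "real n * r", where 'a='a] by (simp add: algebra_simps)
qed simp

text \<open>Distinct constants stay distinct modulo \<open>P\<close>: if a positive constant lay in
  \<open>P\<close>, so would some \<open>1 / real (Suc n)\<close>, and \<open>Suc n\<close> copies
  of that make 1.\<close>

lemma le_mod_const_iff:
  assumes "r \<in> {0..1}" "s \<in> {0..1}"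
  shows "mv_const r \<preceq> mv_const s \<longleftrightarrow> r \<le> s"
proof
  assume *: "mv_const r \<preceq> mv_const s"
  show "r \<le> s"
  proof (rule ccontr)
    assume "\<not> r \<le> s"
    then have "s < r" by simp
    obtain n where n: "1 / real (Suc n) < r - s"
      using reals_Archimedean[of "r - s"] \<open>s < r\<close> by (auto simp: inverse_eq_divide)
    have "mv_const (r - s) \<in> P"
      using * mv_const_diff[of s r, where 'a='a] assms \<open>s < r\<close> by (simp add: le_mod_def)
    moreover have "mv_const (1 / real (Suc n)) \<le> (mv_const (r - s) :: 'a)"
      using n assms by (intro mv_const_mono) auto
    ultimately have "mv_const (1 / real (Suc n)) \<in> P"
      using mv_ideal_down[OF ideal] by blast
    then have "mv_mult (Suc n) (mv_const (1 / real (Suc n))) \<in> P"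
      by (rule mv_ideal_mult[OF ideal])
    then show False
      using mv_mult_const[of "1 / real (Suc n)" "Suc n"] one_notin by (simp add: mv_scale_one del: mv_mult.simps)
  qed
qed (use assms in \<open>auto intro!: le_modI mv_const_mono\<close>)

text \<open>The position of \<open>z\<close> among the constants in the linear order of the
  quotient, a Dedekind cut. Elements that differ infinitesimally modulo \<open>P\<close> get the
  same value.\<close>

definition state_mod :: "'a \<Rightarrow> real"
  where "state_mod z = Sup {r \<in> {0..1}. mv_const r \<preceq> z}"

lemma state_mod_bounds: "state_mod z \<in> {0..1}"
  and state_mod_upper: "r \<in> {0..1} \<Longrightarrow> mv_const r \<preceq> z \<Longrightarrow> r \<le> state_mod z"
  and state_mod_less: "r \<in> {0..1} \<Longrightarrow> r < state_mod z \<Longrightarrow> mv_const r \<preceq> z"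
proof -
  let ?S = "{r \<in> {0..1}. mv_const r \<preceq> z}"
  have 0: "0 \<in> ?S" by (auto intro: le_modI)
  have bdd: "bdd_above ?S" by (auto intro!: bdd_aboveI[of _ 1])
  show "state_mod z \<in> {0..1}"
  proof -
    have "Sup ?S \<le> 1"
    proof (rule cSup_least)
      show "?S \<noteq> {}" using 0 by blast
    qed auto
    then show ?thesis
      unfolding state_mod_def using cSup_upper[OF 0 bdd] by simp
  qed
  show upper: "r \<le> state_mod z" if "r \<in> {0..1}" "mv_const r \<preceq> z" for r
    unfolding state_mod_def using that by (intro cSup_upper[OF _ bdd]) auto
  assume r: "r \<in> {0..1}" "r < state_mod z"
  then obtain s where "s \<in> ?S" "r < s"
    unfolding state_mod_def using less_cSupD[of ?S r] 0 by blast
  with r show "mv_const r \<preceq> z"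
    using le_mod_trans[of "mv_const r" "mv_const s" z] le_mod_const_iff[of r s] by auto
qed

text \<open>Only constants strictly below \<open>s\<close> are compared, since the supremum in
  \<open>state_mod\<close> need not be attained.\<close>

lemma le_state_mod_iff:
  assumes "s \<in> {0..1}"
  shows "s \<le> state_mod z \<longleftrightarrow> (\<forall>r\<in>{0..<s}. mv_const r \<preceq> z)"
proof
  assume "s \<le> state_mod z"
  with assms show "\<forall>r\<in>{0..<s}. mv_const r \<preceq> z" by (auto intro!: state_mod_less)
next
  assume *: "\<forall>r\<in>{0..<s}. mv_const r \<preceq> z"
  show "s \<le> state_mod z"
  \<comment> \<open>Any bound below \<open>s\<close> would do; \<open>-1\<close> is there because
    \<open>s\<close> may be 0. Negative \<open>r\<close> are trivial.\<close>
  proof (rule dense_le_bounded[of "-1"])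
    fix r assume "-1 < r" "r < s"
    show "r \<le> state_mod z"
    proof (cases "0 \<le> r")
      case True
      with * \<open>r < s\<close> assms show ?thesis by (intro state_mod_upper) auto
    qed (use state_mod_bounds[of z] in auto)
  qed (use assms in auto)
qed

text \<open>Here linearity enters: a constant that is not below \<open>z\<close> is above it, so the
  upper cut determines the same number as the lower one.\<close>

lemma state_mod_le_iff:
  assumes "s \<in> {0..1}"
  shows "state_mod z \<le> s \<longleftrightarrow> (\<forall>r\<in>{s<..1}. z \<preceq> mv_const r)"
proof
  assume "state_mod z \<le> s"
  with assms show "\<forall>r\<in>{s<..1}. z \<preceq> mv_const r"
    using le_mod_linear state_mod_upper[of _ z] by (meson atLeastAtMost_iff greaterThanAtMost_iff
        less_le_not_le order_trans)
next
  assume *: "\<forall>r\<in>{s<..1}. z \<preceq> mv_const r"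
  show "state_mod z \<le> s"
  proof (rule ccontr)
    assume "\<not> state_mod z \<le> s"
    then obtain r where r: "s < r" "r < state_mod z" using dense not_le by metis
    then obtain t where t: "r < t" "t < state_mod z" using dense by metis
    have "mv_const t \<preceq> z" "z \<preceq> mv_const r"
      using r t assms state_mod_bounds[of z] * by (auto intro!: state_mod_less)
    then have "mv_const t \<preceq> mv_const r" by (rule le_mod_trans)
    then show False
      using r t assms state_mod_bounds[of z] by (simp add: le_mod_const_iff)
  qed
qed

text \<open>Negation reflects the lower cut of \<open>mv_neg z\<close> onto the upper cut of
  \<open>z\<close>.\<close>

lemma state_mod_neg: "state_mod (mv_neg z) = 1 - state_mod z"
proof -
  have *: "mv_const r \<preceq> mv_neg z \<longleftrightarrow> z \<preceq> mv_const (1 - r)" if "r \<in> {0..1}" for r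
    using le_mod_neg[of z "mv_const (1 - r)"] le_mod_neg[of "mv_const (1 - r)" z] that mv_const_neg[of "1 - r", where 'a='a] by auto
  have "s \<le> state_mod (mv_neg z) \<longleftrightarrow> state_mod z \<le> 1 - s" if "s \<in> {0..1}" for s
  proof -
    have "(\<forall>r\<in>{0..<s}. mv_const r \<preceq> mv_neg z) \<longleftrightarrow> (\<forall>r\<in>{1 - s<..1}. z \<preceq> mv_const r)"
    proof -
      have "{1 - s<..1} = (-) 1 ` {0..<s}" by simp
      then have "(\<forall>r\<in>{1 - s<..1}. z \<preceq> mv_const r) \<longleftrightarrow> (\<forall>r\<in>{0..<s}. z \<preceq> mv_const (1 - r))"
        by (simp only: ball_simps)
      then show ?thesis using that * by simp
    qed
    with that show ?thesis by (simp add: le_state_mod_iff state_mod_le_iff)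
  qed
  from this[of "1 - state_mod z"] this[of "state_mod (mv_neg z)"] show ?thesis
    using state_mod_bounds[of z] state_mod_bounds[of "mv_neg z"] by auto
qed

lemma state_mod_mono: "a \<le> b \<Longrightarrow> state_mod a \<le> state_mod b"
  using le_state_mod_iff[of "state_mod a" b] le_state_mod_iff[of "state_mod a" a] state_mod_bounds[of a] le_mod_trans le_modI
  by blast

lemma state_mod_inf: "state_mod (inf a b) = min (state_mod a) (state_mod b)"
proof (rule order_antisym)
  show "state_mod (inf a b) \<le> min (state_mod a) (state_mod b)" by (simp add: state_mod_mono)
  have "min (state_mod a) (state_mod b) \<in> {0..1}" using state_mod_bounds[of a] state_mod_bounds[of b] by auto
  then show "min (state_mod a) (state_mod b) \<le> state_mod (inf a b)"
    unfolding le_state_mod_iff[OF \<open>min (state_mod a) (state_mod b) \<in> {0..1}\<close>] le_mod_inf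
    by (auto intro!: state_mod_less)
qed

text \<open>Orthogonality enters through \<open>le\<close>: it keeps the sum of the values within
  the unit interval, so that no truncation occurs and the cuts of \<open>a\<close> and
  \<open>b\<close> can be added.\<close>

lemma state_mod_add:
  assumes o: "orthogonal_mv a b"
  shows "state_mod (a \<boxplus> b) = state_mod a + state_mod b"
proof (rule order_antisym)
  note bounds = state_mod_bounds[of a] state_mod_bounds[of b]
  have le: "state_mod a \<le> 1 - state_mod b"
    using o state_mod_mono[of a "mv_neg b"] by (simp add: orthogonal_mv_iff state_mod_neg)
  have "state_mod (a \<boxplus> b) \<le> state_mod a + state_mod b"
  proof (subst state_mod_le_iff)
    show "state_mod a + state_mod b \<in> {0..1}" using bounds le by auto
    show "\<forall>t\<in>{state_mod a + state_mod b<..1}. a \<boxplus> b \<preceq> mv_const t"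
    proof
      fix t assume t: "t \<in> {state_mod a + state_mod b<..1}"
      \<comment> \<open>Half of the gap, so that the two enlarged constants add up to exactly
        \<open>t\<close>.\<close>
      define e where "e = (t - (state_mod a + state_mod b)) / 2"
      have e: "e > 0" using t by (simp add: e_def)
      have s: "t = (state_mod a + e) + (state_mod b + e)" by (simp add: e_def)
      have "a \<preceq> mv_const (state_mod a + e)"
        using state_mod_le_iff[of "state_mod a" a] e t bounds s by auto
      moreover have "b \<preceq> mv_const (state_mod b + e)"
        using state_mod_le_iff[of "state_mod b" b] e t bounds s by auto
      ultimately have "a \<boxplus> b \<preceq> mv_const (state_mod a + e) \<boxplus> mv_const (state_mod b + e)"
        by (rule le_mod_plus)
      also have "mv_const (state_mod a + e) \<boxplus> mv_const (state_mod b + e) = (mv_const t :: 'a)"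
        unfolding s by (rule mv_const_add[symmetric]) (use bounds e t s in auto)
      finally show "a \<boxplus> b \<preceq> mv_const t" .
    qed
  qed
  then show "state_mod (a \<boxplus> b) \<le> state_mod a + state_mod b" .
  have "state_mod a + state_mod b \<le> state_mod (a \<boxplus> b)"
  proof (rule field_le_epsilon)
    fix e :: real assume e: "0 < e"
    \<comment> \<open>Cutting off at 0 keeps \<open>r\<close> a legitimate scalar, and the loss
      against \<open>state_mod a\<close> is at most \<open>e / 2\<close> in either case.\<close>
    define r where "r = max 0 (state_mod a - e / 2)"
    define s where "s = max 0 (state_mod b - e / 2)"
    have "mv_const r \<preceq> a"
      using state_mod_less[of r a] bounds e by (auto simp: r_def max_def intro: le_modI)
    moreover have "mv_const s \<preceq> b"
      using state_mod_less[of s b] bounds e by (auto simp: s_def max_def intro: le_modI)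
    ultimately have "mv_const r \<boxplus> mv_const s \<preceq> a \<boxplus> b"
      by (rule le_mod_plus)
    moreover have rs: "0 \<le> r" "0 \<le> s" "r + s \<le> 1"
      using bounds le e by (auto simp: r_def s_def max_def)
    ultimately have "mv_const (r + s) \<preceq> a \<boxplus> b"
      by (simp add: mv_const_add)
    then have "r + s \<le> state_mod (a \<boxplus> b)"
      using rs by (intro state_mod_upper) auto
    then show "state_mod a + state_mod b \<le> state_mod (a \<boxplus> b) + e"
      by (auto simp: r_def s_def max_def split: if_splits)
  qed
  then show "state_mod a + state_mod b \<le> state_mod (a \<boxplus> b)" .
qed

lemma lattice_state_mod: "lattice_state state_mod"
proof -
  have "1 \<le> state_mod 1" by (intro state_mod_upper le_modI) auto
  then have "state_mod 1 = 1" using state_mod_bounds[of 1] by simp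
  then show ?thesis
    using state_mod_bounds by (simp add: lattice_state_def mv_state_def state_mod_add state_mod_inf)
qed

end

text \<open>A prime ideal that merely misses \<open>x\<close> could leave \<open>x\<close>
  infinitesimal, with value 0. The archimedean property gives a positive constant \<open>c\<close>
  not above \<open>x\<close>; avoiding \<open>x \<ominus> c\<close> instead forces \<open>c\<close>
  below \<open>x\<close> in the quotient, so the value of \<open>x\<close> is at least that of
  \<open>c\<close>.\<close>

lemma lattice_state_pos:
  fixes x :: "'a::convex_sigma_mv_algebra"
  assumes "x \<noteq> 0"
  obtains \<omega> where "lattice_state \<omega>" "\<omega> x > 0"
proof -
  obtain n where n: "\<not> x \<le> mv_const (1 / real (Suc n))"
    using mv_archimedean assms by blast
  define c :: 'a where "c = mv_const (1 / real (Suc n))"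
  have "x \<ominus> c \<noteq> 0" using n by (simp add: mv_diff_eq_zero_iff c_def)
  then obtain P where P: "mv_ideal P" "x \<ominus> c \<notin> P" "\<And>a b. inf a b = 0 \<Longrightarrow> a \<in> P \<or> b \<in> P"
    using prime_ideal_avoiding by blast
  interpret prime_ideal P
    using P mv_ideal_down[OF P(1), of 1] by unfold_locales (auto simp: mv_le_one)
  have "le_mod c x"
    using le_mod_linear[of c x] P(2) by (simp add: le_mod_def)
  then have "1 / real (Suc n) \<le> state_mod x"
    unfolding c_def by (intro state_mod_upper) auto
  moreover have "0 < 1 / real (Suc n)" by simp
  ultimately have "0 < state_mod x" by linarith
  with that lattice_state_mod show thesis by blast
qed

lemma lattice_state_le_iff:
  fixes a b :: "'a::convex_sigma_mv_algebra"
  shows "(\<forall>\<omega>. lattice_state \<omega> \<longrightarrow> \<omega> a \<le> \<omega> b) \<longleftrightarrow> a \<le> b"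
proof
  assume *: "\<forall>\<omega>. lattice_state \<omega> \<longrightarrow> \<omega> a \<le> \<omega> b"
  show "a \<le> b"
  proof (rule ccontr)
    assume "\<not> a \<le> b"
    then obtain \<omega> where "lattice_state \<omega>" "\<omega> (a \<ominus> b) > 0"
      using lattice_state_pos by (metis mv_diff_eq_zero_iff)
    with * show False by (simp add: lattice_state_diff)
  qed
qed (blast intro: mv_state_mono lattice_state_mv_state)

lemma lattice_state_eq_iff:
  fixes a b :: "'a::convex_sigma_mv_algebra"
  shows "(\<forall>\<omega>. lattice_state \<omega> \<longrightarrow> \<omega> a = \<omega> b) \<longleftrightarrow> a = b"
  by (metis lattice_state_le_iff order_antisym order_refl)

section \<open>Meager sets\<close>

lemma nowhere_dense_in_subset: "nowhere_dense_in U A \<Longrightarrow> B \<subseteq> A \<Longrightarrow> nowhere_dense_in U B"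
  unfolding nowhere_dense_in_def
  using interior_of_mono[OF closure_of_mono[of B A U], of U] by auto

lemma meager_in_subset:
  assumes "meager_in U S" "T \<subseteq> S"
  shows "meager_in U T"
proof -
  obtain F where F: "countable F" "\<forall>A\<in>F. nowhere_dense_in U A" "S = \<Union>F"
    using assms(1) by (auto simp: meager_in_def)
  have "T = \<Union>((\<lambda>A. A \<inter> T) ` F)" using F(3) assms(2) by auto
  moreover have "\<forall>A\<in>(\<lambda>A. A \<inter> T) ` F. nowhere_dense_in U A"
    using F(2) nowhere_dense_in_subset by blast
  ultimately show ?thesis
    unfolding meager_in_def using F(1) by blast
qed

lemma meager_in_UN:
  fixes S :: "nat \<Rightarrow> 'x set"
  assumes "\<And>n. meager_in U (S n)"
  shows "meager_in U (\<Union>n. S n)"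
proof -
  obtain F where F: "\<And>n. countable (F n)" "\<And>n. \<forall>A\<in>F n. nowhere_dense_in U A" "\<And>n. S n = \<Union>(F n)"
    using assms unfolding meager_in_def by metis
  show ?thesis
    unfolding meager_in_def by (rule exI[of _ "\<Union>n. F n"]) (use F in auto)
qed

lemma nowhere_dense_in_imp_meager_in: "nowhere_dense_in U S \<Longrightarrow> meager_in U S"
  unfolding meager_in_def by (rule exI[of _ "{S}"]) auto

text \<open>The Baire category theorem, applied to the closures of the nowhere dense pieces.\<close>

lemma meager_in_openin_empty:
  assumes "compact_space U" "Hausdorff_space U" "meager_in U S" "openin U V" "V \<subseteq> S"
  shows "V = {}"
proof -
  obtain F where F: "countable F" "\<And>A. A \<in> F \<Longrightarrow> nowhere_dense_in U A" "S = \<Union>F"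
    using assms(3) by (auto simp: meager_in_def)
  have "U interior_of \<Union>((closure_of) U ` F) = {}"
    using F assms(1,2)
    by (intro Baire_category_alt)
       (auto simp: nowhere_dense_in_def compact_imp_locally_compact_space
         compact_Hausdorff_imp_regular_space)
  moreover have "V \<subseteq> \<Union>((closure_of) U ` F)"
  proof
    fix x assume "x \<in> V"
    then obtain A where A: "A \<in> F" "x \<in> A" using assms(5) F(3) by auto
    then have "A \<subseteq> U closure_of A"
      using F(2) by (auto simp: nowhere_dense_in_def intro!: closure_of_subset)
    with A show "x \<in> \<Union>((closure_of) U ` F)" by auto
  qed
  ultimately show ?thesis
    using interior_of_maximal assms(4) by blast
qed

section \<open>The space of extremal states\<close>

lemma mem_XM_iff: "\<omega> \<in> XM \<longleftrightarrow> lattice_state (\<omega> :: 'a::convex_sigma_mv_algebra \<Rightarrow> real)"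
  by (simp add: extremal_state_iff_lattice_state)

lemma star_apply [simp]: "extremal_state \<omega> \<Longrightarrow> star a \<omega> = \<omega> a"
  by (simp add: star_def)

lemma continuous_on_eval: "continuous_on A (\<lambda>\<omega>::'b \<Rightarrow> real. \<omega> a)"
  by (rule continuous_on_subset[OF continuous_on_product_coordinates]) simp

text \<open>As lattice states, the points are cut out by closed conditions on finitely many
  coordinates each; the definition of extremality offers no such conditions.\<close>

lemma closed_XM: "closed (XM :: ('a::convex_sigma_mv_algebra \<Rightarrow> real) set)"
  unfolding extremal_state_iff_lattice_state lattice_state_def mv_state_def atLeastAtMost_iff
  by (intro closed_Collect_conj closed_Collect_all closed_Collect_imp open_Collect_const
      closed_Collect_le closed_Collect_eq continuous_intros continuous_on_eval)

lemma compact_XM: "compact (XM :: ('a::convex_sigma_mv_algebra \<Rightarrow> real) set)"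
proof -
  have "compactin (product_topology (\<lambda>i::'a. euclideanreal) UNIV) (PiE UNIV (\<lambda>_. {0..1}))"
    by (simp add: compactin_PiE)
  then have "compact (PiE UNIV (\<lambda>_. {0..1}) :: ('a \<Rightarrow> real) set)"
    by (simp add: euclidean_product_topology)
  moreover have "XM \<subseteq> (PiE UNIV (\<lambda>_. {0..1}) :: ('a \<Rightarrow> real) set)"
    by (auto simp: extremal_state_def mv_state_def)
  ultimately show ?thesis
    using closed_XM by (metis Int_absorb1 compact_Int_closed)
qed

lemma compact_space_topXM: "compact_space (topXM :: ('a::convex_sigma_mv_algebra \<Rightarrow> real) topology)"
  using compact_XM by (intro compact_space_subtopology) simp

lemma Hausdorff_space_topXM: "Hausdorff_space (topXM :: ('a::mv_algebra \<Rightarrow> real) topology)"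
proof -
  have "Hausdorff_space (product_topology (\<lambda>i::'a. euclideanreal) UNIV)"
    by (simp add: Hausdorff_space_product_topology)
  then show ?thesis
    by (simp add: euclidean_product_topology Hausdorff_space_subtopology)
qed

section \<open>The category analogue of "almost everywhere"\<close>

definition nearly_everywhere :: "(('a::mv_algebra \<Rightarrow> real) \<Rightarrow> bool) \<Rightarrow> bool"
  where "nearly_everywhere Q \<longleftrightarrow> meager_in topXM {\<omega> \<in> XM. \<not> Q \<omega>}"

lemma nearly_everywhere_mono:
  "nearly_everywhere Q \<Longrightarrow> (\<And>\<omega>. extremal_state \<omega> \<Longrightarrow> Q \<omega> \<Longrightarrow> R \<omega>) \<Longrightarrow> nearly_everywhere R"
  unfolding nearly_everywhere_def by (erule meager_in_subset) auto

lemma nearly_everywhere_all: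
  assumes "\<And>n::nat. nearly_everywhere (Q n)"
  shows "nearly_everywhere (\<lambda>\<omega>. \<forall>n. Q n \<omega>)"
proof -
  have "meager_in topXM (\<Union>n. {\<omega> \<in> XM. \<not> Q n \<omega>})"
    using assms unfolding nearly_everywhere_def by (rule meager_in_UN)
  then show ?thesis
    unfolding nearly_everywhere_def by (rule meager_in_subset) auto
qed

lemma nearly_everywhere_conj:
  assumes "nearly_everywhere Q" "nearly_everywhere R"
  shows "nearly_everywhere (\<lambda>\<omega>. Q \<omega> \<and> R \<omega>)"
proof -
  have "nearly_everywhere (\<lambda>\<omega>. \<forall>n::nat. (if n = 0 then Q else R) \<omega>)"
    by (rule nearly_everywhere_all) (use assms in simp)
  then show ?thesis
    by (rule nearly_everywhere_mono) (metis zero_neq_one)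
qed

lemma nearly_everywhere_always: "(\<And>\<omega>. extremal_state \<omega> \<Longrightarrow> Q \<omega>) \<Longrightarrow> nearly_everywhere Q"
proof -
  assume "\<And>\<omega>. extremal_state \<omega> \<Longrightarrow> Q \<omega>"
  then have eq: "{\<omega> \<in> XM. \<not> Q \<omega>} = {}" by auto
  show ?thesis
    unfolding nearly_everywhere_def eq
    by (intro nowhere_dense_in_imp_meager_in) (simp add: nowhere_dense_in_def)
qed

text \<open>By continuity the exceptional set is open, and an open meager set is empty.\<close>

lemma nearly_everywhere_le:
  fixes f g :: "('a::convex_sigma_mv_algebra \<Rightarrow> real) \<Rightarrow> real"
  assumes "nearly_everywhere (\<lambda>\<omega>. f \<omega> \<le> g \<omega>)" "continuous_on XM f" "continuous_on XM g"
    and "extremal_state \<omega>"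
  shows "f \<omega> \<le> g \<omega>"
proof -
  have "openin topXM (XM \<inter> (\<lambda>\<omega>. f \<omega> - g \<omega>) -` {0<..})"
    using assms(2,3) by (intro continuous_openin_preimage_gen continuous_intros) auto
  also have "XM \<inter> (\<lambda>\<omega>. f \<omega> - g \<omega>) -` {0<..} = {\<omega> \<in> XM. \<not> f \<omega> \<le> g \<omega>}" by auto
  finally have "{\<omega> \<in> XM. \<not> f \<omega> \<le> g \<omega>} = {}"
    using assms(1) unfolding nearly_everywhere_def
    by (intro meager_in_openin_empty[OF compact_space_topXM Hausdorff_space_topXM]) auto
  with assms(4) show ?thesis by auto
qed

lemma extremal_state_le_iff:
  fixes a b :: "'a::convex_sigma_mv_algebra"
  shows "nearly_everywhere (\<lambda>\<omega>. \<omega> a \<le> \<omega> b) \<longleftrightarrow> a \<le> b"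
proof
  assume "nearly_everywhere (\<lambda>\<omega>. \<omega> a \<le> \<omega> b)"
  then have "\<omega> a \<le> \<omega> b" if "extremal_state \<omega>" for \<omega>
    by (rule nearly_everywhere_le[of "\<lambda>\<omega>. \<omega> a" "\<lambda>\<omega>. \<omega> b"])
       (use that \<open>nearly_everywhere _\<close> in \<open>auto intro: continuous_on_eval\<close>)
  then show "a \<le> b"
    by (simp add: extremal_state_iff_lattice_state flip: lattice_state_le_iff)
next
  assume "a \<le> b"
  then show "nearly_everywhere (\<lambda>\<omega>. \<omega> a \<le> \<omega> b)"
    by (intro nearly_everywhere_always mv_state_mono) (auto simp: extremal_state_def)
qed

text \<open>A tent of height \<open>e\<close> over the point \<open>r = \<omega> a\<close>, written
  as an element of the algebra: the sum of the two truncated differences of \<open>a\<close> and the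
  constant evaluates to the distance \<open>\<bar>\<psi> a - r\<bar>\<close>.\<close>

lemma lattice_state_bump:
  fixes a :: "'a::convex_sigma_mv_algebra"
  assumes \<omega>: "lattice_state \<omega>" and X: "open X" "\<omega> a \<in> X"
  shows "\<exists>c. \<omega> c > 0 \<and> (\<forall>\<psi>. lattice_state \<psi> \<longrightarrow> \<psi> c > 0 \<longrightarrow> \<psi> a \<in> X)"
proof -
  obtain \<epsilon> where \<epsilon>: "\<epsilon> > 0" "ball (\<omega> a) \<epsilon> \<subseteq> X"
    using X by (rule openE)
  \<comment> \<open>The height is kept at most 1 so that it can serve as a constant of the
    algebra.\<close>
  define e where "e = min \<epsilon> 1"
  have e: "0 < e" "e \<le> 1" "ball (\<omega> a) e \<subseteq> X"
    using \<epsilon> unfolding e_def by (auto simp: subset_eq)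
  define r where "r = \<omega> a"
  have r: "r \<in> {0..1}"
    using lattice_state_mv_state[OF \<omega>] by (simp add: r_def mv_state_nonneg mv_state_le_one)
  define c where "c = mv_const e \<ominus> ((a \<ominus> mv_const r) \<boxplus> (mv_const r \<ominus> a))"
  have c: "\<psi> c = max 0 (e - min 1 \<bar>\<psi> a - r\<bar>)" if "lattice_state \<psi>" for \<psi>
    unfolding c_def using that e r mv_state_const[OF lattice_state_mv_state[OF that]]
    by (auto simp: lattice_state_diff lattice_state_plus max_def abs_if)
  show ?thesis
  proof (intro exI[of _ c] conjI allI impI)
    show "\<omega> c > 0" using c[OF \<omega>] e by (simp add: r_def)
    fix \<psi> assume \<psi>: "lattice_state \<psi>" "\<psi> c > 0"
    then have "\<bar>\<psi> a - r\<bar> < e" using c[OF \<psi>(1)] e by (auto simp: max_def min_def split: if_splits)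
    then show "\<psi> a \<in> X" using e(3) by (auto simp: subset_eq dist_real_def r_def abs_minus_commute)
  qed
qed

text \<open>The algebra supplies its own Urysohn functions: a basic open set of the product topology
  restricts finitely many coordinates, and the meet of one tent for each of them is supported inside
  it.\<close>

lemma extremal_state_bump:
  fixes \<omega> :: "'a::convex_sigma_mv_algebra \<Rightarrow> real"
  assumes V: "openin topXM V" and \<omega>: "\<omega> \<in> V"
  obtains c where "\<omega> c > 0" "\<And>\<psi>. extremal_state \<psi> \<Longrightarrow> \<psi> \<notin> V \<Longrightarrow> \<psi> c = 0"
proof -
  obtain W where W: "open W" "V = XM \<inter> W"
    using V by (auto simp: openin_open)
  have ls: "lattice_state \<omega>" using \<omega> W mem_XM_iff by blast
  have "openin (product_topology (\<lambda>i::'a. euclideanreal) UNIV) W"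
    using W(1) by (simp add: euclidean_product_topology)
  then obtain X where X: "\<omega> \<in> PiE UNIV X" "\<And>i. open (X i)" "finite {i. X i \<noteq> UNIV}" "PiE UNIV X \<subseteq> W"
    using product_topology_open_contains_basis[of "\<lambda>i::'a. euclideanreal" UNIV W \<omega>] W \<omega> by auto
  have "\<exists>c. \<omega> c > 0 \<and> (\<forall>\<psi>. lattice_state \<psi> \<longrightarrow> \<psi> c > 0 \<longrightarrow> (\<forall>i\<in>J. \<psi> i \<in> X i))"
    if "finite J" for J
    using that
  proof induction
    case empty
    show ?case using mv_state_one[OF lattice_state_mv_state[OF ls]] by (auto intro!: exI[of _ 1])
  next
    case (insert i J)
    then obtain c where c: "\<omega> c > 0" "\<And>\<psi>. lattice_state \<psi> \<Longrightarrow> \<psi> c > 0 \<Longrightarrow> (\<forall>i\<in>J. \<psi> i \<in> X i)"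
      by blast
    obtain d where d: "\<omega> d > 0" "\<And>\<psi>. lattice_state \<psi> \<Longrightarrow> \<psi> d > 0 \<Longrightarrow> \<psi> i \<in> X i"
      using lattice_state_bump[OF ls X(2), of i i] X(1) by auto
    show ?case
      by (rule exI[of _ "inf c d"]) (use c d ls in \<open>auto simp: lattice_state_inf\<close>)
  qed
  from this[OF X(3)] obtain c where c: "\<omega> c > 0"
    "\<And>\<psi>. lattice_state \<psi> \<Longrightarrow> \<psi> c > 0 \<Longrightarrow> (\<forall>i\<in>{i. X i \<noteq> UNIV}. \<psi> i \<in> X i)"
    by blast
  show thesis
  proof (rule that[of c])
    fix \<psi> :: "'a \<Rightarrow> real" assume \<psi>: "extremal_state \<psi>" "\<psi> \<notin> V"
    then have ls: "lattice_state \<psi>" by (simp add: extremal_state_iff_lattice_state)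
    have "\<not> \<psi> c > 0"
    proof
      assume "\<psi> c > 0"
      with c(2)[OF ls] have "\<psi> i \<in> X i" for i by (cases "X i = UNIV") auto
      then have "\<psi> \<in> V" using X(4) W(2) \<psi>(1) by (auto simp: PiE_def Pi_def)
      with \<psi>(2) show False ..
    qed
    then show "\<psi> c = 0"
      using mv_state_nonneg[OF lattice_state_mv_state[OF ls], of c] by simp
  qed (rule c(1))
qed

lemma increases_to_real_iff:
  "increases_to u l \<longleftrightarrow> incseq u \<and> u \<longlonglongrightarrow> (l::real)"
proof
  assume *: "increases_to u l"
  have "u \<longlonglongrightarrow> l"
  proof (rule increasing_LIMSEQ)
    fix e :: real assume "0 < e"
    then have "\<not> (\<forall>n. u n \<le> l - e)" using * by (force simp: increases_to_def)
    then obtain n where "l - e < u n" by (auto simp: not_le)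
    then have "l \<le> u n + e" by simp
    then show "\<exists>n. l \<le> u n + e" ..
  qed (use * in \<open>auto simp: increases_to_def incseq_SucD\<close>)
  with * show "incseq u \<and> u \<longlonglongrightarrow> l" by (simp add: increases_to_def)
next
  assume "incseq u \<and> u \<longlonglongrightarrow> l"
  then show "increases_to u l"
    by (auto simp: increases_to_def incseq_le intro: LIMSEQ_le_const2)
qed

lemma increases_to_Sup:
  fixes a :: "nat \<Rightarrow> 'a::countable_complete_lattice"
  shows "incseq a \<Longrightarrow> increases_to a (Sup (range a))"
  by (auto simp: increases_to_def intro!: ccSup_upper ccSup_least)

lemma increases_to_unique: "increases_to u a \<Longrightarrow> increases_to u b \<Longrightarrow> a = b"
  by (auto simp: increases_to_def intro: order_antisym)

text \<open>Countable suprema in \<open>M\<close> are pointwise suprema up to a meager set: on an open set where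
  they differed by \<open>1/k\<close>, a bump function could be subtracted from the supremum.\<close>

lemma increases_to_nearly_everywhere:
  fixes a :: "nat \<Rightarrow> 'a::convex_sigma_mv_algebra"
  assumes "increases_to a l"
  shows "nearly_everywhere (\<lambda>\<omega>. (\<lambda>n. \<omega> (a n)) \<longlonglongrightarrow> \<omega> l)"
proof -
  have le: "a n \<le> l" and least: "(\<And>n. a n \<le> v) \<Longrightarrow> l \<le> v" and inc: "incseq a" for n v
    using assms by (auto simp: increases_to_def)
  \<comment> \<open>A point where the values fail to converge to \<open>\<omega> l\<close> keeps a
    positive distance from it and so lies in some \<open>E k\<close>.\<close>
  define E where "E k = {\<omega> \<in> XM. \<forall>n. \<omega> (a n) + 1 / real (Suc k) \<le> \<omega> l}" for k
  have "nowhere_dense_in topXM (E k)" for k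
  proof -
    have cl: "closed (E k)"
      unfolding E_def using closed_XM
      by (intro closed_Collect_conj closed_Collect_all closed_Collect_le continuous_intros
          continuous_on_eval) simp
    have sub: "E k \<subseteq> XM" by (auto simp: E_def)
    have "topXM closure_of E k = E k"
      using cl sub by (simp add: closure_of_eq closed_subset)
    moreover have "topXM interior_of E k = {}"
    proof (rule ccontr)
      define V where "V = topXM interior_of E k"
      have V: "openin topXM V" "V \<subseteq> E k" by (auto simp: V_def interior_of_subset)
      assume "topXM interior_of E k \<noteq> {}"
      then obtain \<omega> where \<omega>: "\<omega> \<in> V" unfolding V_def by blast
      obtain c where c: "\<omega> c > 0" and c0: "\<And>\<psi>. extremal_state \<psi> \<Longrightarrow> \<psi> \<notin> V \<Longrightarrow> \<psi> c = 0"
        using extremal_state_bump[OF V(1) \<omega>] by blast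
      define e where "e = 1 / real (Suc k)"
      have e: "0 < e" "e \<in> {0..1}" by (auto simp: e_def)
      have E: "\<psi> (a n) + e \<le> \<psi> l" if "\<psi> \<in> V" for \<psi> n
        using V(2) that by (auto simp: E_def e_def)
      have \<omega>E: "\<omega> \<in> XM" using \<omega> V(2) sub by (meson subsetD)
      then have ls: "lattice_state \<omega>" by (simp only: mem_XM_iff)
      \<comment> \<open>Cut at height \<open>e\<close>, the bump fits into the gap: on
        \<open>V\<close> the values of \<open>a n\<close> stay \<open>e\<close> below those of
        \<open>l\<close>, and off \<open>V\<close> the bump vanishes. So
        \<open>l \<ominus> d\<close> is still an upper bound.\<close>
      define d where "d = inf c (mv_const e)"
      have d: "\<psi> d = min (\<psi> c) e" if "lattice_state \<psi>" for \<psi>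
        using mv_state_const[OF lattice_state_mv_state[OF that] e(2)]
        by (simp only: d_def lattice_state_inf[OF that])
      have "a n \<le> l \<ominus> d" for n
      proof -
        have "\<psi> (a n) \<le> \<psi> (l \<ominus> d)" if \<psi>: "lattice_state \<psi>" for \<psi>
        proof (cases "\<psi> \<in> V")
          case True
          from E[OF this, of n] show ?thesis
            using d[OF \<psi>] by (simp add: lattice_state_diff[OF \<psi>])
        next
          case False
          then have "\<psi> c = 0" using c0 \<psi> by (simp add: extremal_state_iff_lattice_state)
          moreover have "\<psi> (a n) \<le> \<psi> l"
            using mv_state_mono[OF lattice_state_mv_state[OF \<psi>] le] .
          ultimately show ?thesis using d[OF \<psi>] e(1) by (simp add: lattice_state_diff[OF \<psi>])
        qed
        then show ?thesis using lattice_state_le_iff by blast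
      qed
      then have "l \<le> l \<ominus> d" by (rule least)
      then have "\<omega> l \<le> max 0 (\<omega> l - \<omega> d)"
        using mv_state_mono[OF lattice_state_mv_state[OF ls]] lattice_state_diff[OF ls] by metis
      moreover have "\<omega> d > 0" using d[OF ls] c e by simp
      \<comment> \<open>The difference is truncated at 0, so subtracting \<open>d\<close> lowers the
        value strictly only where \<open>l\<close> is positive.\<close>
      moreover have "\<omega> l > 0"
        using E[OF \<omega>, of 0] e(1) mv_state_nonneg[OF lattice_state_mv_state[OF ls], of "a 0"] by linarith
      ultimately show False by simp
    qed
    ultimately show ?thesis using sub by (simp add: nowhere_dense_in_def)
  qed
  then have "meager_in topXM (\<Union>k. E k)"
    by (intro meager_in_UN nowhere_dense_in_imp_meager_in)
  then show ?thesis
    unfolding nearly_everywhere_def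
  proof (rule meager_in_subset, intro subsetI)
    fix \<omega> assume "\<omega> \<in> {\<omega> \<in> XM. \<not> (\<lambda>n. \<omega> (a n)) \<longlonglongrightarrow> \<omega> l}"
    then have \<omega>: "\<omega> \<in> XM" "\<not> (\<lambda>n. \<omega> (a n)) \<longlonglongrightarrow> \<omega> l" by auto
    then have st: "mv_state \<omega>" by (simp add: extremal_state_def)
    have "\<exists>e>0. \<forall>n. \<not> \<omega> l \<le> \<omega> (a n) + e"
    proof (rule ccontr)
      assume "\<not> ?thesis"
      then have "(\<lambda>n. \<omega> (a n)) \<longlonglongrightarrow> \<omega> l"
        using inc le by (intro increasing_LIMSEQ mv_state_mono[OF st]) (auto simp: incseq_SucD)
      with \<omega>(2) show False ..
    qed
    then obtain e where e: "e > 0" "\<And>n. \<omega> (a n) + e \<le> \<omega> l" by (auto simp: not_le less_imp_le)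
    obtain k where "1 / real (Suc k) < e"
      using reals_Archimedean[OF e(1)] by (auto simp: inverse_eq_divide)
    then have "\<omega> (a n) + 1 / real (Suc k) \<le> \<omega> l" for n
      using e(2)[of n] by linarith
    then have "\<omega> \<in> E k"
      using \<omega>(1) unfolding E_def by blast
    then show "\<omega> \<in> (\<Union>k. E k)" by blast
  qed
qed

section \<open>Tribes\<close>

lemma tribe_bounds: "tribe X T \<Longrightarrow> f \<in> T \<Longrightarrow> x \<in> X \<Longrightarrow> 0 \<le> f x \<and> f x \<le> 1"
  and tribe_extensional: "tribe X T \<Longrightarrow> f \<in> T \<Longrightarrow> f \<in> extensional X"
  and tribe_zero: "tribe X T \<Longrightarrow> (\<lambda>x\<in>X. 0) \<in> T"
  and tribe_compl: "tribe X T \<Longrightarrow> f \<in> T \<Longrightarrow> (\<lambda>x\<in>X. 1 - f x) \<in> T"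
  and tribe_plus: "tribe X T \<Longrightarrow> f \<in> T \<Longrightarrow> g \<in> T \<Longrightarrow> (\<lambda>x\<in>X. min (f x + g x) 1) \<in> T"
  by (auto simp: tribe_def PiE_def Pi_def subset_iff)

lemma tribe_limit:
  assumes "tribe X T" "\<And>n. u n \<in> T" "f \<in> extensional X"
    "\<And>x. x \<in> X \<Longrightarrow> increases_to (\<lambda>n. u n x) (f x)"
  shows "f \<in> T"
  using assms unfolding tribe_def by blast

lemma tribe_one: "tribe X T \<Longrightarrow> (\<lambda>x\<in>X. 1) \<in> T"
proof -
  assume T: "tribe X T"
  have "(\<lambda>x\<in>X. 1) = (\<lambda>x\<in>X. 1 - (\<lambda>x\<in>X. 0::real) x)"
    by (rule restrict_ext) simp
  then show ?thesis
    using tribe_compl[OF T tribe_zero[OF T]] by (simp only:)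
qed

lemma tribe_diff:
  assumes "tribe X T" "f \<in> T" "g \<in> T"
  shows "(\<lambda>x\<in>X. max 0 (f x - g x)) \<in> T"
proof -
  have "(\<lambda>x\<in>X. max 0 (f x - g x)) =
      (\<lambda>x\<in>X. 1 - (\<lambda>x\<in>X. min ((\<lambda>x\<in>X. 1 - f x) x + g x) 1) x)"
    by (rule restrict_ext) (simp add: max_def min_def)
  then show ?thesis
    using assms by (simp only: tribe_compl tribe_plus)
qed

lemma tribe_min:
  assumes "tribe X T" "f \<in> T" "g \<in> T"
  shows "(\<lambda>x\<in>X. min (f x) (g x)) \<in> T"
proof -
  have "(\<lambda>x\<in>X. min (f x) (g x)) = (\<lambda>x\<in>X. max 0 (f x - (\<lambda>x\<in>X. max 0 (f x - g x)) x))"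
    using tribe_bounds[OF assms(1,2)] tribe_bounds[OF assms(1,3)]
    by (intro restrict_ext) (simp add: max_def min_def)
  then show ?thesis
    using assms by (simp only: tribe_diff)
qed

lemma tribe_setsI: "B \<subseteq> X \<Longrightarrow> chi X B \<in> T \<Longrightarrow> B \<in> tribe_sets X T"
  and tribe_setsD: "B \<in> tribe_sets X T \<Longrightarrow> B \<subseteq> X" "B \<in> tribe_sets X T \<Longrightarrow> chi X B \<in> T"
  by (auto simp: tribe_sets_def)

lemma chi_increases:
  assumes "incseq A" "x \<in> X"
  shows "increases_to (\<lambda>n. chi X (A n) x) (chi X (\<Union>n. A n) x)"
proof -
  have lim: "(\<lambda>n. indicator (A n) x :: real) \<longlonglongrightarrow> indicator (\<Union>n. A n) x"
    using assms(1) by (rule LIMSEQ_indicator_incseq)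
  have "incseq (\<lambda>n. chi X (A n) x)"
    using assms by (auto simp: chi_def incseq_def indicator_def subset_eq)
  moreover have "(\<lambda>n. chi X (A n) x) \<longlonglongrightarrow> chi X (\<Union>n. A n) x"
    using assms lim by (simp add: chi_def)
  ultimately show ?thesis by (simp add: increases_to_real_iff)
qed

lemma sigma_algebra_tribe_sets:
  assumes T: "tribe X T"
  shows "sigma_algebra X (tribe_sets X T)"
  unfolding sigma_algebra_iff2
proof (intro conjI ballI allI impI)
  show "tribe_sets X T \<subseteq> Pow X" by (auto simp: tribe_sets_def)
  show empty: "{} \<in> tribe_sets X T"
    using tribe_zero[OF T] by (intro tribe_setsI) (auto simp: chi_def)
  fix B assume B: "B \<in> tribe_sets X T"
  have "chi X (X - B) = (\<lambda>x\<in>X. 1 - chi X B x)"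
    unfolding chi_def by (intro restrict_ext) (simp add: indicator_def)
  then show "X - B \<in> tribe_sets X T"
    using tribe_compl[OF T tribe_setsD(2)[OF B]] by (intro tribe_setsI) auto
next
  fix A :: "nat \<Rightarrow> 'a set" assume A: "range A \<subseteq> tribe_sets X T"
  have un: "B \<union> C \<in> tribe_sets X T" if B: "B \<in> tribe_sets X T" "C \<in> tribe_sets X T" for B C
  proof -
    have "chi X (B \<union> C) = (\<lambda>x\<in>X. min (chi X B x + chi X C x) 1)"
      unfolding chi_def by (intro restrict_ext) (simp add: indicator_def)
    then show ?thesis
      using tribe_plus[OF T B[THEN tribe_setsD(2)]] B[THEN tribe_setsD(1)] by (intro tribe_setsI) auto
  qed
  have empty: "{} \<in> tribe_sets X T"
    using tribe_zero[OF T] by (intro tribe_setsI) (auto simp: chi_def)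
  have part: "(\<Union>i<n. A i) \<in> tribe_sets X T" for n
  proof (induction n)
    case (Suc n)
    then show ?case using un[of "A n" "\<Union>i<n. A i"] A by (auto simp: lessThan_Suc)
  qed (simp add: empty)
  have eq: "(\<Union>n. \<Union>i<n. A i) = (\<Union>i. A i)" by auto
  have inc: "incseq (\<lambda>n. \<Union>i<n. A i)" by (intro monoI) force
  have "chi X (\<Union>i. A i) \<in> T"
    by (rule tribe_limit[OF T, of "\<lambda>n. chi X (\<Union>i<n. A i)"])
       (use part[THEN tribe_setsD(2)] chi_increases[OF inc] in \<open>auto simp: eq chi_def\<close>)
  then show "(\<Union>i. A i) \<in> tribe_sets X T"
    using A by (intro tribe_setsI) (auto simp: tribe_sets_def)
qed

text \<open>With constants at hand, \<open>f - r\<close> truncated at 0 stays in the tribe, which is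
  how level sets are reached. For \<open>star_tribe N\<close> they come from convexity of
  \<open>N\<close>.\<close>

locale tribe_with_constants =
  fixes X :: "'x set" and T :: "('x \<Rightarrow> real) set"
  assumes tribe: "tribe X T"
    and const: "0 \<le> r \<Longrightarrow> r \<le> 1 \<Longrightarrow> (\<lambda>x\<in>X. r) \<in> T"
begin

text \<open>The multiples of the truncated difference of \<open>f\<close> and \<open>r\<close>,
  capped at 1, are repeated truncated sums and increase to the indicator of the set.\<close>

lemma superlevel:
  assumes f: "f \<in> T" and r: "0 \<le> r" "r \<le> 1"
  shows "{x \<in> X. r < f x} \<in> tribe_sets X T"
proof (rule tribe_setsI)
  define g where "g = (\<lambda>x\<in>X. max 0 (f x - (\<lambda>x\<in>X. r) x))"
  have g: "g \<in> T" unfolding g_def by (rule tribe_diff[OF tribe f const[OF r]])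
  have gx: "x \<in> X \<Longrightarrow> g x = max 0 (f x - r)" for x by (simp add: g_def)
  have u: "(\<lambda>x\<in>X. min 1 (real n * g x)) \<in> T" for n
  proof (induction n)
    case (Suc n)
    have "(\<lambda>x\<in>X. min 1 (real (Suc n) * g x)) = (\<lambda>x\<in>X. min ((\<lambda>x\<in>X. min 1 (real n * g x)) x + g x) 1)"
      by (intro restrict_ext) (simp add: gx min_def algebra_simps max_def)
    then show ?case using tribe_plus[OF tribe Suc g] by (simp only:)
  next
    case 0
    have "(\<lambda>x\<in>X. min 1 (real 0 * g x)) = (\<lambda>x\<in>X. 0)" by (rule restrict_ext) simp
    then show ?case using tribe_zero[OF tribe] by (simp only:)
  qed
  show "chi X {x \<in> X. r < f x} \<in> T"
  proof (rule tribe_limit[OF tribe u])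
    fix x assume x: "x \<in> X"
    have "incseq (\<lambda>n. min 1 (real n * g x))"
      using x by (intro monoI min.mono mult_right_mono) (auto simp: gx)
    moreover have "(\<lambda>n. min 1 (real n * g x)) \<longlonglongrightarrow> indicator {x \<in> X. r < f x} x"
    proof (cases "r < f x")
      case True
      then have "0 < g x" using x by (simp add: gx)
      then obtain N where N: "1 < real N * g x" using reals_Archimedean3 by blast
      have "eventually (\<lambda>n. min 1 (real n * g x) = 1) sequentially"
        using eventually_ge_at_top[of N]
      proof eventually_elim
        case (elim n)
        then have "real N * g x \<le> real n * g x" using \<open>0 < g x\<close> by simp
        with N show ?case by simp
      qed
      with True x show ?thesis by (simp add: tendsto_eventually)
    next
      case False
      with x show ?thesis by (simp add: gx max_def)
    qed
    ultimately show "increases_to (\<lambda>n. (\<lambda>x\<in>X. min 1 (real n * g x)) x) (chi X {x \<in> X. r < f x} x)"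
      using x by (simp add: increases_to_real_iff chi_def)
  qed (simp add: chi_def)
qed auto

lemma sets_sigma: "sets (sigma X (tribe_sets X T)) = tribe_sets X T"
  using sigma_algebra_tribe_sets[OF tribe]
  by (simp add: sigma_algebra.sets_measure_of_eq)

lemma measurable:
  assumes f: "f \<in> T"
  shows "f \<in> borel_measurable (sigma X (tribe_sets X T))"
proof -
  interpret S: sigma_algebra X "tribe_sets X T" by (rule sigma_algebra_tribe_sets[OF tribe])
  have "{x \<in> X. r < f x} \<in> tribe_sets X T" for r
  proof -
    consider "r < 0" | "0 \<le> r" "r \<le> 1" | "1 < r" by linarith
    then show ?thesis
    proof cases
      case 1
      then have "{x \<in> X. r < f x} = X" using tribe_bounds[OF tribe f] by fastforce
      then show ?thesis by (simp only: S.top)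
    next
      case 3
      then have "{x \<in> X. r < f x} = {}" using tribe_bounds[OF tribe f] by fastforce
      then show ?thesis by (simp only: S.empty_sets)
    qed (rule superlevel[OF f])
  qed
  then show ?thesis
    unfolding borel_measurable_iff_greater sets_sigma by (simp add: space_measure_of_conv)
qed

section \<open>Additive functionals on a tribe and their integral representation\<close>

definition tribe_additive :: "(('x \<Rightarrow> real) \<Rightarrow> real) \<Rightarrow> bool"
  where "tribe_additive J \<longleftrightarrow>
    (\<forall>f\<in>T. 0 \<le> J f) \<and>
    (\<forall>f\<in>T. \<forall>g\<in>T. (\<forall>x\<in>X. f x + g x \<le> 1) \<longrightarrow> J (\<lambda>x\<in>X. f x + g x) = J f + J g)"

lemma tribe_additive_nonneg: "tribe_additive J \<Longrightarrow> f \<in> T \<Longrightarrow> 0 \<le> J f"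
  by (simp add: tribe_additive_def)

lemma tribe_additive_add:
  assumes "tribe_additive J" "f \<in> T" "g \<in> T" "\<And>x. x \<in> X \<Longrightarrow> f x + g x \<le> 1"
    and "h \<in> extensional X" "\<And>x. x \<in> X \<Longrightarrow> h x = f x + g x"
  shows "J h = J f + J g"
proof -
  have "h = (\<lambda>x\<in>X. f x + g x)"
    using assms(5,6) by (auto simp: fun_eq_iff extensional_def)
  then show ?thesis using assms by (simp add: tribe_additive_def)
qed

lemma tribe_additive_mono:
  assumes J: "tribe_additive J" and fg: "f \<in> T" "g \<in> T" "\<And>x. x \<in> X \<Longrightarrow> f x \<le> g x"
  shows "J f \<le> J g"
proof -
  note d = tribe_diff[OF tribe fg(2,1)]
  have "J g = J f + J (\<lambda>x\<in>X. max 0 (g x - f x))"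
    using fg tribe_bounds[OF tribe fg(2)]
    by (intro tribe_additive_add[OF J] d tribe_extensional[OF tribe]) auto
  then show ?thesis using tribe_additive_nonneg[OF J d] by simp
qed

lemma tribe_additive_zero:
  assumes "tribe_additive J" shows "J (\<lambda>x\<in>X. 0) = 0"
  using tribe_additive_add[OF assms tribe_zero[OF tribe] tribe_zero[OF tribe], of "\<lambda>x\<in>X. 0"] by simp

text \<open>The mesh of the slicing: \<open>Suc n\<close> layers of height \<open>\<epsilon>\<close>
  fill the unit interval exactly.\<close>

context
  fixes \<epsilon> :: real and n :: nat
  assumes eps: "0 < \<epsilon>" "real (Suc n) * \<epsilon> = 1"
begin

lemma eps_mult_le: "j \<le> Suc n \<Longrightarrow> real j * \<epsilon> \<le> 1"
  using mult_right_mono[of "real j" "real (Suc n)" \<epsilon>] eps by linarith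

text \<open>The summand with index \<open>j\<close> is the part of \<open>f\<close> between the
  heights \<open>real j * \<epsilon>\<close> and \<open>real (Suc j) * \<epsilon>\<close>. It is the
  increment between two truncations of \<open>f\<close>, so the sum telescopes.\<close>

lemma tribe_additive_slices:
  assumes J: "tribe_additive J" and f: "f \<in> T"
  shows "J f = (\<Sum>j<Suc n. J (\<lambda>x\<in>X. max 0 (min (f x - real j * \<epsilon>) \<epsilon>)))"
proof -
  define c where "c j = (\<lambda>x\<in>X. min (f x) ((\<lambda>x\<in>X. real j * \<epsilon>) x))" for j
  define g where "g j = (\<lambda>x\<in>X. max 0 (min (f x - real j * \<epsilon>) \<epsilon>))" for j
  have cx: "c j x = min (f x) (real j * \<epsilon>)" if "x \<in> X" for j x
    using that by (simp add: c_def)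
  have gx: "g j x = max 0 (min (f x - real j * \<epsilon>) \<epsilon>)" if "x \<in> X" for j x
    using that by (simp add: g_def)
  have c: "c j \<in> T" if "j \<le> Suc n" for j
    unfolding c_def using eps(1) eps_mult_le[OF that] by (intro tribe_min[OF tribe f] const) auto
  have "J (c k) = (\<Sum>j<k. J (g j))" if "k \<le> Suc n" for k
    using that
  proof (induction k)
    case 0
    have "c 0 = (\<lambda>x\<in>X. 0)"
      unfolding c_def
    proof (rule restrict_ext)
      fix x assume "x \<in> X"
      then show "min (f x) ((\<lambda>x\<in>X. real 0 * \<epsilon>) x) = 0"
        using tribe_bounds[OF tribe f, of x] by simp
    qed
    then have "J (c 0) = 0" using tribe_additive_zero[OF J] by (simp only:)
    then show ?case by simp
  next
    case (Suc k)
    have step: "real (Suc k) * \<epsilon> = real k * \<epsilon> + \<epsilon>" by (simp add: algebra_simps)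
    have g: "g k = (\<lambda>x\<in>X. max 0 (c (Suc k) x - c k x))"
      unfolding g_def using eps(1) by (intro restrict_ext) (auto simp: cx step min_def max_def simp del: of_nat_Suc)
    have "J (c (Suc k)) = J (c k) + J (g k)"
    proof (rule tribe_additive_add[OF J])
      show "c k \<in> T" using Suc.prems by (intro c) simp
      show "g k \<in> T"
        unfolding g using Suc.prems by (intro tribe_diff[OF tribe] c) auto
      fix x assume x: "x \<in> X"
      show eq: "c (Suc k) x = c k x + g k x"
        using eps(1) by (auto simp: cx[OF x] gx[OF x] step min_def max_def simp del: of_nat_Suc)
      show "c k x + g k x \<le> 1"
        using eq cx[OF x, of "Suc k"] tribe_bounds[OF tribe f x] by linarith
    qed (simp add: c_def)
    then show ?case using Suc by simp
  qed
  from this[of "Suc n"] have "J (c (Suc n)) = (\<Sum>j<Suc n. J (g j))" by blast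
  moreover have "c (Suc n) = f"
    using tribe_bounds[OF tribe f] tribe_extensional[OF tribe f] eps(2)
    by (auto simp: fun_eq_iff extensional_def c_def)
  ultimately show ?thesis by (simp only: g_def)
qed

text \<open>All \<open>Suc n\<close> slices of an indicator are the same function \<open>h\<close>.
  This gives homogeneity for the factor \<open>\<epsilon>\<close> from additivity alone.\<close>

lemma tribe_additive_chi:
  assumes J: "tribe_additive J" and A: "A \<in> tribe_sets X T"
  defines "h \<equiv> \<lambda>x\<in>X. min (chi X A x) ((\<lambda>x\<in>X. \<epsilon>) x)"
  shows "J h = \<epsilon> * J (chi X A)" and "h \<in> T"
proof -
  have eps1: "\<epsilon> \<le> 1" using eps_mult_le[of 1] by simp
  have "(\<lambda>x\<in>X. max 0 (min (chi X A x - real j * \<epsilon>) \<epsilon>)) = h" if "j < Suc n" for j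
    unfolding h_def
  proof (rule restrict_ext)
    fix x assume "x \<in> X"
    define t where "t = real j * \<epsilon>"
    have "0 \<le> t" "t + \<epsilon> \<le> 1"
      using eps_mult_le[of "Suc j"] that eps(1) by (auto simp: t_def algebra_simps)
    moreover have "chi X A x = 0 \<or> chi X A x = 1"
      using \<open>x \<in> X\<close> by (simp add: chi_def indicator_def)
    ultimately show "max 0 (min (chi X A x - real j * \<epsilon>) \<epsilon>) = min (chi X A x) ((\<lambda>x\<in>X. \<epsilon>) x)"
      using \<open>x \<in> X\<close> eps(1) eps1 unfolding t_def[symmetric] by (auto simp: max_def min_def)
  qed
  then have "J (chi X A) = (\<Sum>j<Suc n. J h)"
    unfolding tribe_additive_slices[OF J tribe_setsD(2)[OF A]] by (intro sum.cong) auto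
  then have "\<epsilon> * J (chi X A) = (real (Suc n) * \<epsilon>) * J h"
    by (simp only: sum_constant card_lessThan mult_ac)
  then show "J h = \<epsilon> * J (chi X A)" unfolding eps(2) by simp
  show "h \<in> T"
    unfolding h_def using eps(1) eps1
    by (intro tribe_min[OF tribe tribe_setsD(2)[OF A]] const) auto
qed

text \<open>Each slice of \<open>f\<close> lies between \<open>\<epsilon>\<close> times the
  indicators of the superlevel sets at its upper and at its lower edge. Summed over the slices, the
  two bounds are the same list shifted by one place, so they differ by at most its first
  term.\<close>

lemma tribe_additive_approx:
  assumes J: "tribe_additive J" and f: "f \<in> T"
  defines "S \<equiv> (\<Sum>j<Suc n. \<epsilon> * J (chi X {x \<in> X. real j * \<epsilon> < f x}))"
  shows "J f \<le> S" "S \<le> J f + \<epsilon> * J (\<lambda>x\<in>X. 1)"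
proof -
  define A where "A j = {x \<in> X. real j * \<epsilon> < f x}" for j
  have A: "A j \<in> tribe_sets X T" if "j \<le> Suc n" for j
    unfolding A_def using that eps(1) by (intro superlevel[OF f] eps_mult_le) auto
  define g where "g j = (\<lambda>x\<in>X. max 0 (min (f x - real j * \<epsilon>) \<epsilon>))" for j
  define h where "h j = (\<lambda>x\<in>X. min (chi X (A j) x) ((\<lambda>x\<in>X. \<epsilon>) x))" for j
  have eps1: "\<epsilon> \<le> 1" using eps_mult_le[of 1] by simp
  have h: "h j \<in> T" "J (h j) = \<epsilon> * J (chi X (A j))" if "j \<le> Suc n" for j
    unfolding h_def using tribe_additive_chi[OF J A[OF that]] by auto
  have hx: "h j x = (if real j * \<epsilon> < f x then \<epsilon> else 0)" if "x \<in> X" for j x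
    using that eps(1) eps1 by (simp add: h_def chi_def A_def indicator_def)
  have gx: "g j x = max 0 (min (f x - real j * \<epsilon>) \<epsilon>)" if "x \<in> X" for j x
    using that by (simp add: g_def)
  have g: "g j \<in> T" if "j < Suc n" for j
  proof -
    have "g j = (\<lambda>x\<in>X. min ((\<lambda>x\<in>X. max 0 (f x - (\<lambda>x\<in>X. real j * \<epsilon>) x)) x) ((\<lambda>x\<in>X. \<epsilon>) x))"
      unfolding g_def using eps(1) by (intro restrict_ext) (simp add: min_def max_def)
    also have "\<dots> \<in> T"
      using that eps(1) eps1 eps_mult_le[of j]
      by (intro tribe_min[OF tribe] tribe_diff[OF tribe] f const) auto
    finally show ?thesis .
  qed
  have upper: "J (g j) \<le> J (h j)" if "j < Suc n" for j
    using that eps(1) by (intro tribe_additive_mono[OF J] g h) (auto simp: gx hx)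
  have lower: "J (h (Suc j)) \<le> J (g j)" if "j < Suc n" for j
  proof (intro tribe_additive_mono[OF J] g h)
    fix x assume x: "x \<in> X"
    have "real (Suc j) * \<epsilon> = real j * \<epsilon> + \<epsilon>" by (simp add: algebra_simps)
    then show "h (Suc j) x \<le> g j x"
      using eps(1) by (auto simp: gx[OF x] hx[OF x] simp del: of_nat_Suc)
  qed (use that in auto)
  have S: "S = (\<Sum>j<Suc n. J (h j))"
    unfolding S_def A_def[symmetric] by (intro sum.cong) (use h in auto)
  have Jf: "J f = (\<Sum>j<Suc n. J (g j))"
    using tribe_additive_slices[OF J f] by (simp only: g_def)
  show "J f \<le> S"
    unfolding S Jf by (intro sum_mono upper) auto
  \<comment> \<open>The added term completes the list at its far end, so that splitting off
    \<open>h 0\<close> leaves exactly the lower bounds of the slices.\<close>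
  have "S \<le> S + J (h (Suc n))" using tribe_additive_nonneg[OF J h(1)] by simp
  also have "\<dots> = J (h 0) + (\<Sum>j<Suc n. J (h (Suc j)))"
    unfolding S using sum.lessThan_Suc[of "\<lambda>j. J (h j)" "Suc n"]
      sum.lessThan_Suc_shift[of "\<lambda>j. J (h j)" "Suc n"] by linarith
  also have "\<dots> \<le> J (h 0) + J f"
    unfolding Jf by (intro add_left_mono sum_mono lower) auto
  also have "J (h 0) \<le> \<epsilon> * J (\<lambda>x\<in>X. 1)"
    unfolding h(2)[OF le0] using eps(1)
    by (intro mult_left_mono tribe_additive_mono[OF J tribe_setsD(2)[OF A] tribe_one[OF tribe]])
       (auto simp: chi_def indicator_def)
  finally show "S \<le> J f + \<epsilon> * J (\<lambda>x\<in>X. 1)" by simp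
qed

end

text \<open>The approximating sum sees only the values on sets, so it is common to \<open>J\<close>
  and \<open>K\<close>, and both are within a multiple of the mesh of it.\<close>

lemma tribe_additive_unique:
  assumes J: "tribe_additive J" and K: "tribe_additive K"
    and eq: "\<And>A. A \<in> tribe_sets X T \<Longrightarrow> J (chi X A) = K (chi X A)" and f: "f \<in> T"
  shows "J f = K f"
proof -
  define C where "C = J (\<lambda>x\<in>X. 1) + K (\<lambda>x\<in>X. 1)"
  have "\<bar>J f - K f\<bar> \<le> C / real (Suc n)" for n
  proof -
    define \<epsilon> where "\<epsilon> = 1 / real (Suc n)"
    have eps: "0 < \<epsilon>" "real (Suc n) * \<epsilon> = 1" by (auto simp: \<epsilon>_def)
    have S: "(\<Sum>j<Suc n. \<epsilon> * J (chi X {x \<in> X. real j * \<epsilon> < f x})) =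
        (\<Sum>j<Suc n. \<epsilon> * K (chi X {x \<in> X. real j * \<epsilon> < f x}))"
      using eps(1) eps_mult_le[OF eps]
      by (intro sum.cong refl arg_cong[where f = "\<lambda>t. \<epsilon> * t"] eq superlevel[OF f]) auto
    have "0 \<le> \<epsilon> * J (\<lambda>x\<in>X. 1)" "0 \<le> \<epsilon> * K (\<lambda>x\<in>X. 1)"
      using tribe_additive_nonneg[OF _ tribe_one[OF tribe]] J K eps(1) by auto
    then have "\<bar>J f - K f\<bar> \<le> \<epsilon> * J (\<lambda>x\<in>X. 1) + \<epsilon> * K (\<lambda>x\<in>X. 1)"
      using tribe_additive_approx[OF eps J f] tribe_additive_approx[OF eps K f] S by linarith
    also have "\<dots> = C / real (Suc n)" by (simp add: C_def \<epsilon>_def add_divide_distrib)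
    finally show ?thesis .
  qed
  moreover have "(\<lambda>n. C / real (Suc n)) \<longlonglongrightarrow> 0"
    using LIMSEQ_Suc[OF lim_const_over_n[of C]] by simp
  ultimately have "\<bar>J f - K f\<bar> \<le> 0"
    by (intro LIMSEQ_le_const) auto
  then show ?thesis by simp
qed

text \<open>\<open>cont\<close> makes the set function a measure. Integration against it is again an
  additive functional with the same values on indicators, hence equals \<open>J\<close> by
  \<open>tribe_additive_unique\<close>.\<close>

lemma tribe_additive_integral:
  assumes J: "tribe_additive J"
    and cont: "\<And>A. range A \<subseteq> tribe_sets X T \<Longrightarrow> incseq A \<Longrightarrow>
      (\<lambda>n. J (chi X (A n))) \<longlonglongrightarrow> J (chi X (\<Union>n. A n))"
    and f: "f \<in> T"
  shows "has_bochner_integral (measure_of X (tribe_sets X T) (\<lambda>A. ennreal (J (chi X A)))) f (J f)"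
proof -
  interpret S: sigma_algebra X "tribe_sets X T" by (rule sigma_algebra_tribe_sets[OF tribe])
  define \<mu> where "\<mu> = (\<lambda>A. ennreal (J (chi X A)))"
  define M where "M = measure_of X (tribe_sets X T) \<mu>"
  have chi: "chi X A \<in> T" if "A \<in> tribe_sets X T" for A
    using that by (rule tribe_setsD)
  have pos: "positive (tribe_sets X T) \<mu>"
  proof -
    have "chi X {} = (\<lambda>x\<in>X. 0)" unfolding chi_def by (rule restrict_ext) simp
    then have "J (chi X {}) = 0" using tribe_additive_zero[OF J] by (simp only:)
    then show ?thesis by (simp add: positive_def \<mu>_def)
  qed
  have add: "Measure_Space.additive (tribe_sets X T) \<mu>"
    unfolding Measure_Space.additive_def
  proof (intro ballI impI)
    fix A B assume *: "A \<in> tribe_sets X T" "B \<in> tribe_sets X T" "A \<inter> B = {}"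
    have "J (chi X (A \<union> B)) = J (chi X A) + J (chi X B)"
      by (rule tribe_additive_add[OF J chi[OF *(1)] chi[OF *(2)]])
         (use *(3) in \<open>auto simp: chi_def indicator_def\<close>)
    then show "\<mu> (A \<union> B) = \<mu> A + \<mu> B"
      using tribe_additive_nonneg[OF J] chi * by (simp add: \<mu>_def)
  qed
  have ca: "countably_additive (tribe_sets X T) \<mu>"
  proof (subst S.countably_additive_iff_continuous_from_below[OF pos add], intro allI impI)
    fix A :: "nat \<Rightarrow> 'x set" assume "range A \<subseteq> tribe_sets X T" "incseq A"
    then show "(\<lambda>i. \<mu> (A i)) \<longlonglongrightarrow> \<mu> (\<Union>i. A i)"
      unfolding \<mu>_def by (intro tendsto_ennrealI cont)
  qed
  have em: "emeasure M A = \<mu> A" if "A \<in> tribe_sets X T" for A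
    unfolding M_def by (rule emeasure_measure_of_sigma[OF S.sigma_algebra_axioms pos ca that])
  have sets: "sets M = tribe_sets X T" and space: "space M = X"
    unfolding M_def by (auto simp: S.sets_measure_of_eq S.space_measure_of_eq)
  interpret M: finite_measure M
    by (rule finite_measureI) (simp add: space em \<mu>_def)
  have int: "integrable M g" if g: "g \<in> T" for g
  proof (rule M.integrable_const_bound)
    show "AE x in M. norm (g x) \<le> 1"
      using tribe_bounds[OF tribe g] by (intro AE_I2) (auto simp: space)
    have "borel_measurable M = (borel_measurable (sigma X (tribe_sets X T)) :: ('x \<Rightarrow> real) set)"
      by (rule measurable_cong_sets) (simp_all add: sets sets_sigma)
    then show "g \<in> borel_measurable M" using measurable[OF g] by simp
  qed
  have K: "tribe_additive (integral\<^sup>L M)"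
    unfolding tribe_additive_def
  proof (intro conjI ballI impI)
    fix g assume g: "g \<in> T"
    show "0 \<le> integral\<^sup>L M g"
      using tribe_bounds[OF tribe g] by (intro integral_nonneg_AE AE_I2) (auto simp: space)
    fix h assume h: "h \<in> T"
    have "integral\<^sup>L M (\<lambda>x\<in>X. g x + h x) = (\<integral>x. g x + h x \<partial>M)"
      by (intro Bochner_Integration.integral_cong) (auto simp: space)
    then show "integral\<^sup>L M (\<lambda>x\<in>X. g x + h x) = integral\<^sup>L M g + integral\<^sup>L M h"
      using int g h by simp
  qed
  have "integral\<^sup>L M f = J f"
  proof (rule tribe_additive_unique[OF K J _ f])
    fix A assume A: "A \<in> tribe_sets X T"
    have "integral\<^sup>L M (chi X A) = (\<integral>x. indicator A x \<partial>M)"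
      by (intro Bochner_Integration.integral_cong) (auto simp: space chi_def)
    also have "\<dots> = measure M A"
      using tribe_setsD(1)[OF A] by (simp add: space Int_absorb2)
    also have "\<dots> = J (chi X A)"
      using tribe_additive_nonneg[OF J chi[OF A]] by (simp add: measure_def em[OF A] \<mu>_def)
    finally show "integral\<^sup>L M (chi X A) = J (chi X A)" .
  qed
  then have "has_bochner_integral M f (J f)"
    using int[OF f] by (simp add: has_bochner_integral_iff)
  then show ?thesis by (simp only: M_def \<mu>_def)
qed

end

lemma tribe_generated_tribe:
  assumes "G \<subseteq> (X \<rightarrow>\<^sub>E {0..1})"
  shows "tribe X (generated_tribe X G)"
proof -
  \<comment> \<open>A member of the family that is intersected: it rules out the empty intersection
    and bounds the values by 0 and 1.\<close>
  have full: "tribe X (X \<rightarrow>\<^sub>E {0..1})"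
    unfolding tribe_def
  proof (intro conjI ballI allI impI)
    fix u and f :: "'a \<Rightarrow> real"
    assume *: "\<forall>n. u n \<in> X \<rightarrow>\<^sub>E {0..1}" "f \<in> extensional X" "\<forall>x\<in>X. increases_to (\<lambda>n. u n x) (f x)"
    have "f x \<in> {0..1}" if x: "x \<in> X" for x
    proof -
      have "(\<lambda>n. u n x) \<longlonglongrightarrow> f x" using *(3) x by (simp add: increases_to_real_iff)
      moreover have "u n x \<in> {0..1}" for n using *(1) x by blast
      ultimately show ?thesis by (rule closed_sequentially[OF closed_atLeastAtMost, rotated])
    qed
    with *(2) show "f \<in> X \<rightarrow>\<^sub>E {0..1}" by (auto simp: PiE_def)
  qed (auto simp: min_def PiE_iff)
  let ?\<F> = "{T. tribe X T \<and> G \<subseteq> T}"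
  have sub: "\<Inter>?\<F> \<subseteq> (X \<rightarrow>\<^sub>E {0..1})" using full assms by blast
  show ?thesis
    unfolding generated_tribe_def tribe_def[of X "\<Inter>?\<F>"]
  proof (intro conjI ballI allI impI)
    fix u and f :: "'a \<Rightarrow> real"
    assume *: "\<forall>n. u n \<in> \<Inter>?\<F>" "f \<in> extensional X" "\<forall>x\<in>X. increases_to (\<lambda>n. u n x) (f x)"
    show "f \<in> \<Inter>?\<F>"
    proof (rule InterI)
      fix T assume T: "T \<in> ?\<F>"
      have "tribe X T" "u n \<in> T" for n using T *(1) by blast+
      then show "f \<in> T" using *(2) by (rule tribe_limit[of X T u]) (use *(3) in blast)
    qed
  qed (use sub in \<open>auto intro: tribe_zero tribe_compl tribe_plus\<close>)
qed

lemma generated_tribe_superset: "G \<subseteq> generated_tribe X G"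
  and generated_tribe_least: "tribe X T \<Longrightarrow> G \<subseteq> T \<Longrightarrow> generated_tribe X G \<subseteq> T"
  by (auto simp: generated_tribe_def)

section \<open>The Loomis--Sikorski representation\<close>

text \<open>The relation underlying \<open>eta\<close>, free of the description operator; facts are
  proved for it and carried over by \<open>eta_eq\<close>.\<close>

definition represents :: "(('a::mv_algebra \<Rightarrow> real) \<Rightarrow> real) \<Rightarrow> 'a \<Rightarrow> bool"
  where "represents f a \<longleftrightarrow> nearly_everywhere (\<lambda>\<omega>. f \<omega> = \<omega> a)"

lemma represents_unique:
  fixes a b :: "'a::convex_sigma_mv_algebra"
  assumes "represents f a" "represents f b"
  shows "a = b"
proof -
  have "nearly_everywhere (\<lambda>\<omega>. f \<omega> = \<omega> a \<and> f \<omega> = \<omega> b)"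
    using assms unfolding represents_def by (rule nearly_everywhere_conj)
  then have "nearly_everywhere (\<lambda>\<omega>. \<omega> a \<le> \<omega> b)" "nearly_everywhere (\<lambda>\<omega>. \<omega> b \<le> \<omega> a)"
    by (auto elim!: nearly_everywhere_mono)
  then show ?thesis by (simp add: extremal_state_le_iff order_antisym)
qed

lemma represents_iff_meager:
  "represents f a \<longleftrightarrow> meager_in topXM {\<omega> \<in> XM. f \<omega> \<noteq> star a \<omega>}"
  unfolding represents_def nearly_everywhere_def
  by (rule arg_cong[where f = "meager_in topXM"]) auto

lemma eta_eq: "represents f a \<Longrightarrow> eta f = (a::'a::convex_sigma_mv_algebra)"
  unfolding eta_def represents_iff_meager[symmetric] by (blast intro: represents_unique)

lemma represents_cong:
  "represents f a \<Longrightarrow> (\<And>\<omega>. extremal_state \<omega> \<Longrightarrow> f \<omega> = \<omega> a \<Longrightarrow> g \<omega> = \<omega> b) \<Longrightarrow> represents g b"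
  unfolding represents_def by (rule nearly_everywhere_mono)

lemma represents_cong2:
  assumes "represents f a" "represents g b"
    and "\<And>\<omega>. extremal_state \<omega> \<Longrightarrow> f \<omega> = \<omega> a \<Longrightarrow> g \<omega> = \<omega> b \<Longrightarrow> h \<omega> = \<omega> c"
  shows "represents h c"
  unfolding represents_def
  using nearly_everywhere_conj[OF assms(1,2)[unfolded represents_def]]
  by (rule nearly_everywhere_mono) (use assms(3) in blast)

lemma represents_always: "(\<And>\<omega>. extremal_state \<omega> \<Longrightarrow> f \<omega> = \<omega> a) \<Longrightarrow> represents f a"
  unfolding represents_def by (rule nearly_everywhere_always)

lemma represents_star: "represents (star a) a"
  by (rule represents_always) simp

text \<open>The pointwise bound gives \<open>\<omega> a \<le> \<omega> (mv_neg b)\<close> off a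
  meager set, which is already an inequality in the algebra, so \<open>a\<close> and
  \<open>b\<close> are orthogonal there too.\<close>

lemma represents_add:
  fixes a b :: "'a::convex_sigma_mv_algebra"
  assumes "represents f a" "represents g b"
    and le: "\<And>\<omega>. extremal_state \<omega> \<Longrightarrow> f \<omega> + g \<omega> \<le> 1"
  shows "orthogonal_mv a b" "represents (\<lambda>\<omega>\<in>XM. f \<omega> + g \<omega>) (a \<boxplus> b)"
proof -
  have "nearly_everywhere (\<lambda>\<omega>. f \<omega> = \<omega> a \<and> g \<omega> = \<omega> b)"
    using assms(1,2) unfolding represents_def by (rule nearly_everywhere_conj)
  then have "nearly_everywhere (\<lambda>\<omega>. \<omega> a \<le> \<omega> (mv_neg b))"
  proof (rule nearly_everywhere_mono)
    fix \<omega> :: "'a \<Rightarrow> real" assume \<omega>: "extremal_state \<omega>" "f \<omega> = \<omega> a \<and> g \<omega> = \<omega> b"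
    then show "\<omega> a \<le> \<omega> (mv_neg b)"
      using le[OF \<omega>(1)] mv_state_neg[of \<omega> b] by (simp add: extremal_state_def)
  qed
  then show o: "orthogonal_mv a b" by (simp add: extremal_state_le_iff orthogonal_mv_iff)
  show "represents (\<lambda>\<omega>\<in>XM. f \<omega> + g \<omega>) (a \<boxplus> b)"
    using assms(1,2)
    by (rule represents_cong2) (use o in \<open>simp add: extremal_state_def mv_state_add\<close>)
qed

text \<open>This is the sigma-additivity of \<open>eta\<close>. The exceptional points are those
  where some \<open>u n\<close> differs from \<open>a n\<close>, together with those where the
  supremum in the algebra is not the pointwise one: countably many meager sets.\<close>

lemma represents_increases:
  fixes a :: "nat \<Rightarrow> 'a::convex_sigma_mv_algebra"
  assumes u: "\<And>n. represents (u n) (a n)"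
    and inc: "\<And>\<omega>. extremal_state \<omega> \<Longrightarrow> increases_to (\<lambda>n. u n \<omega>) (f \<omega>)"
  shows "increases_to a (Sup (range a))" "represents f (Sup (range a))"
proof -
  have mono: "a m \<le> a n" if "m \<le> n" for m n
  proof -
    have "nearly_everywhere (\<lambda>\<omega>. u m \<omega> = \<omega> (a m) \<and> u n \<omega> = \<omega> (a n))"
      using u unfolding represents_def by (intro nearly_everywhere_conj)
    then have "nearly_everywhere (\<lambda>\<omega>. \<omega> (a m) \<le> \<omega> (a n))"
    proof (rule nearly_everywhere_mono)
      fix \<omega> :: "'a \<Rightarrow> real" assume \<omega>: "extremal_state \<omega>" "u m \<omega> = \<omega> (a m) \<and> u n \<omega> = \<omega> (a n)"
      have "u m \<omega> \<le> u n \<omega>" using inc[OF \<omega>(1)] that by (auto simp: increases_to_def incseq_def)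
      with \<omega>(2) show "\<omega> (a m) \<le> \<omega> (a n)" by simp
    qed
    then show ?thesis by (simp add: extremal_state_le_iff)
  qed
  then show l: "increases_to a (Sup (range a))"
    by (intro increases_to_Sup monoI)
  have "nearly_everywhere (\<lambda>\<omega>. \<forall>n. u n \<omega> = \<omega> (a n))"
    using u unfolding represents_def by (rule nearly_everywhere_all)
  with increases_to_nearly_everywhere[OF l]
  have "nearly_everywhere (\<lambda>\<omega>. (\<lambda>n. \<omega> (a n)) \<longlonglongrightarrow> \<omega> (Sup (range a)) \<and> (\<forall>n. u n \<omega> = \<omega> (a n)))"
    by (rule nearly_everywhere_conj)
  then show "represents f (Sup (range a))"
    unfolding represents_def
  proof (rule nearly_everywhere_mono)
    fix \<omega> :: "'a \<Rightarrow> real"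
    assume \<omega>: "extremal_state \<omega>"
      "(\<lambda>n. \<omega> (a n)) \<longlonglongrightarrow> \<omega> (Sup (range a)) \<and> (\<forall>n. u n \<omega> = \<omega> (a n))"
    then have "(\<lambda>n. \<omega> (a n)) \<longlonglongrightarrow> f \<omega>"
      using inc[OF \<omega>(1)] by (simp add: increases_to_real_iff)
    with \<omega>(2) show "f \<omega> = \<omega> (Sup (range a))" using LIMSEQ_unique by blast
  qed
qed

lemma tribe_represented:
  "tribe XM {f \<in> XM \<rightarrow>\<^sub>E {0..1}. \<exists>a::'a::convex_sigma_mv_algebra. represents f a}"
  (is "tribe XM ?L")
  unfolding tribe_def
proof (intro conjI ballI allI impI)
  have "represents (\<lambda>\<omega>\<in>XM. 0) (0::'a)"
    by (rule represents_always) (simp add: mv_state_zero extremal_state_def)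
  then show "(\<lambda>\<omega>\<in>XM. 0) \<in> ?L" by auto
next
  fix f assume "f \<in> ?L"
  then obtain a :: 'a where f: "f \<in> XM \<rightarrow>\<^sub>E {0..1}" "represents f a" by blast
  from f(2) have "represents (\<lambda>\<omega>\<in>XM. 1 - f \<omega>) (mv_neg a)"
    by (rule represents_cong) (simp add: extremal_state_def mv_state_neg)
  moreover have "(\<lambda>\<omega>\<in>XM. 1 - f \<omega>) \<in> XM \<rightarrow>\<^sub>E {0..1}"
    using f(1) by (auto simp: PiE_iff)
  ultimately show "(\<lambda>\<omega>\<in>XM. 1 - f \<omega>) \<in> ?L" by blast
next
  fix f g assume "f \<in> ?L" "g \<in> ?L"
  then obtain a b :: 'a where f: "f \<in> XM \<rightarrow>\<^sub>E {0..1}" "represents f a"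
    and g: "g \<in> XM \<rightarrow>\<^sub>E {0..1}" "represents g b" by blast
  from f(2) g(2) have "represents (\<lambda>\<omega>\<in>XM. min (f \<omega> + g \<omega>) 1) (a \<boxplus> b)"
    by (rule represents_cong2)
       (simp add: extremal_state_iff_lattice_state lattice_state_plus min.commute)
  moreover have "(\<lambda>\<omega>\<in>XM. min (f \<omega> + g \<omega>) 1) \<in> XM \<rightarrow>\<^sub>E {0..1}"
    using f(1) g(1) by (auto simp: PiE_iff min_def)
  ultimately show "(\<lambda>\<omega>\<in>XM. min (f \<omega> + g \<omega>) 1) \<in> ?L" by blast
next
  fix u and f :: "('a \<Rightarrow> real) \<Rightarrow> real"
  assume *: "\<forall>n. u n \<in> ?L" "f \<in> extensional XM" "\<forall>\<omega>\<in>XM. increases_to (\<lambda>n. u n \<omega>) (f \<omega>)"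
  from *(1) have "\<forall>n. \<exists>a::'a. represents (u n) a" by blast
  then obtain a :: "nat \<Rightarrow> 'a" where "\<And>n. represents (u n) (a n)" by metis
  then have "represents f (Sup (range a))"
    by (rule represents_increases) (use *(3) in auto)
  moreover have "f \<in> XM \<rightarrow>\<^sub>E {0..1}"
  proof -
    have "f \<omega> \<in> {0..1}" if "\<omega> \<in> XM" for \<omega>
    proof -
      have "u n \<omega> \<in> {0..1}" for n using *(1) that by blast
      moreover have "(\<lambda>n. u n \<omega>) \<longlonglongrightarrow> f \<omega>" using *(3) that by (simp add: increases_to_real_iff)
      ultimately show ?thesis by (rule closed_sequentially[OF closed_atLeastAtMost])
    qed
    with *(2) show ?thesis by (auto simp: PiE_def)
  qed
  ultimately show "f \<in> ?L" by blast
qed auto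

lemma star_in_PiE: "star a \<in> XM \<rightarrow>\<^sub>E {0..1}"
  by (auto simp: star_def extremal_state_def mv_state_def)

lemma tribe_star_tribe: "tribe XM (star_tribe N)"
  unfolding star_tribe_def using star_in_PiE by (intro tribe_generated_tribe) blast

lemma star_in_star_tribe: "a \<in> N \<Longrightarrow> star a \<in> star_tribe N"
  unfolding star_tribe_def by (rule subsetD[OF generated_tribe_superset imageI])

text \<open>The represented functions form a tribe containing every \<open>star a\<close>, and the
  generated tribe is the least such.\<close>

lemma represents_eta:
  assumes "f \<in> star_tribe (N :: 'a::convex_sigma_mv_algebra set)"
  shows "represents f (eta f)"
proof -
  have "star_tribe N \<subseteq> {f \<in> XM \<rightarrow>\<^sub>E {0..1}. \<exists>a::'a. represents f a}"
    unfolding star_tribe_def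
    by (rule generated_tribe_least[OF tribe_represented])
       (intro image_subsetI CollectI conjI exI, rule star_in_PiE, rule represents_star)
  with assms obtain a where "represents f a" by blast
  then show ?thesis using eta_eq by metis
qed

lemma tribe_with_constants_star_tribe:
  fixes N :: "'a::convex_sigma_mv_algebra set"
  assumes "convex_sub N" "1 \<in> N"
  shows "tribe_with_constants XM (star_tribe N)"
proof
  show "tribe XM (star_tribe N)" by (rule tribe_star_tribe)
  fix r :: real assume r: "0 \<le> r" "r \<le> 1"
  have "(\<lambda>\<omega>\<in>XM. r) = star (mv_const r :: 'a)"
    unfolding star_def
    by (rule restrict_ext) (use r in \<open>simp add: extremal_state_def mv_state_const\<close>)
  moreover have "mv_const r \<in> N" using assms r by (auto simp: convex_sub_def)
  ultimately show "(\<lambda>\<omega>\<in>XM. r) \<in> star_tribe N" by (simp only: star_in_star_tribe)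
qed

lemma boolean_inf_neg:
  fixes b :: "'a::sigma_mv_algebra"
  assumes "b \<boxplus> b = b"
  shows "inf b (mv_neg b) = 0"
  using mv_plus_diff_cancel[of b b] mv_diff_eq_zero_iff[of b b] assms by simp

text \<open>The functional \<open>J\<close> cuts \<open>f\<close> down to the support of
  \<open>star b\<close>. An idempotent of the truncated sum is 0 or 1 at every point, and therefore
  the cut is additive in \<open>f\<close>. On indicators \<open>J\<close> is the set function of
  \<open>P_star\<close>, and at \<open>star c\<close> the cut represents
  \<open>inf c b\<close>.\<close>

lemma integral_P_star:
  fixes m :: "'a::convex_sigma_mv_algebra \<Rightarrow> real"
  assumes m: "sigma_additive_state m" and b: "b \<boxplus> b = b"
  shows "has_bochner_integral (P_star m b) (star c) (m (inf c b))"
proof -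
  interpret T: tribe_with_constants XM "star_tribe (UNIV :: 'a set)"
    by (rule tribe_with_constants_star_tribe) (auto simp: convex_sub_def)
  let ?T = "star_tribe (UNIV :: 'a set)"
  have st: "mv_state m" using m by (simp add: sigma_additive_state_def)
  have b01: "star b \<omega> = 0 \<or> star b \<omega> = 1" if "\<omega> \<in> XM" for \<omega>
  proof -
    have "lattice_state \<omega>" using that by (simp add: extremal_state_iff_lattice_state)
    then have "\<omega> b = min 1 (\<omega> b + \<omega> b)" using lattice_state_plus[of \<omega> b b] b by simp
    then show ?thesis using that by (auto simp: min_def split: if_splits)
  qed
  define q where "q f = (\<lambda>\<omega>\<in>XM. min (star b \<omega>) (f \<omega>))" for f
  define J where "J f = m (eta (q f))" for f
  have q: "q f \<in> ?T" if "f \<in> ?T" for f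
    unfolding q_def by (rule tribe_min[OF T.tribe star_in_star_tribe that]) simp
  have J: "T.tribe_additive J"
    unfolding T.tribe_additive_def
  proof (intro conjI ballI impI)
    fix f assume f: "f \<in> ?T"
    show "0 \<le> J f" by (simp add: J_def mv_state_nonneg[OF st])
    fix g assume g: "g \<in> ?T" and le: "\<forall>\<omega>\<in>XM. f \<omega> + g \<omega> \<le> 1"
    have eq: "q (\<lambda>\<omega>\<in>XM. f \<omega> + g \<omega>) = (\<lambda>\<omega>\<in>XM. q f \<omega> + q g \<omega>)"
      unfolding q_def
    proof (rule restrict_ext)
      fix \<omega> :: "'a \<Rightarrow> real" assume \<omega>: "\<omega> \<in> XM"
      show "min (star b \<omega>) ((\<lambda>\<omega>\<in>XM. f \<omega> + g \<omega>) \<omega>) =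
          (\<lambda>\<omega>\<in>XM. min (star b \<omega>) (f \<omega>)) \<omega> + (\<lambda>\<omega>\<in>XM. min (star b \<omega>) (g \<omega>)) \<omega>"
        using b01[OF \<omega>] \<omega> le tribe_bounds[OF T.tribe f \<omega>] tribe_bounds[OF T.tribe g \<omega>]
        by (auto simp: min_def simp del: star_apply)
    qed
    have "q f \<omega> + q g \<omega> \<le> 1" if "extremal_state \<omega>" for \<omega>
    proof -
      have "q f \<omega> \<le> f \<omega>" "q g \<omega> \<le> g \<omega>" using that by (auto simp: q_def)
      moreover have "f \<omega> + g \<omega> \<le> 1" using le that by simp
      ultimately show ?thesis by linarith
    qed
    note add = represents_add[OF represents_eta[OF q[OF f]] represents_eta[OF q[OF g]] this]
    show "J (\<lambda>\<omega>\<in>XM. f \<omega> + g \<omega>) = J f + J g"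
      unfolding J_def eq using eta_eq[OF add(2)] mv_state_add[OF st add(1)] by simp
  qed
  have cont: "(\<lambda>n. J (chi XM (A n))) \<longlonglongrightarrow> J (chi XM (\<Union>n. A n))"
    if A: "range A \<subseteq> tribe_sets XM ?T" "incseq A" for A
  proof -
    have r: "represents (q (chi XM (A n))) (eta (q (chi XM (A n))))" for n
    proof -
      have "chi XM (A n) \<in> ?T" using A(1) by (intro tribe_setsD(2)) auto
      then show ?thesis by (intro represents_eta[of _ UNIV] q)
    qed
    have inc: "increases_to (\<lambda>n. q (chi XM (A n)) \<omega>) (q (chi XM (\<Union>n. A n)) \<omega>)"
      if "extremal_state \<omega>" for \<omega>
    proof -
      have \<omega>: "\<omega> \<in> XM" using that by simp
      have "increases_to (\<lambda>n. chi XM (A n) \<omega>) (chi XM (\<Union>n. A n) \<omega>)"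
        by (rule chi_increases[OF A(2) \<omega>])
      then show ?thesis
        unfolding increases_to_real_iff q_def restrict_apply'[OF \<omega>]
        by (auto intro!: tendsto_min tendsto_const simp: incseq_def min.coboundedI2)
    qed
    note lim = represents_increases[OF r inc]
    have "increases_to (\<lambda>n. J (chi XM (A n))) (m (Sup (range (\<lambda>n. eta (q (chi XM (A n)))))))"
      using m lim(1) unfolding sigma_additive_state_def J_def by blast
    then show ?thesis
      unfolding increases_to_real_iff by (simp add: J_def eta_eq[OF lim(2)])
  qed
  have "has_bochner_integral (measure_of XM (tribe_sets XM ?T) (\<lambda>A. ennreal (J (chi XM A))))
      (star c) (J (star c))"
    by (rule T.tribe_additive_integral[OF J cont star_in_star_tribe]) auto
  moreover have "J (star c) = m (inf c b)"
  proof -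
    have "represents (q (star c)) (inf c b)"
      unfolding q_def
      by (rule represents_always)
         (simp add: extremal_state_iff_lattice_state lattice_state_inf min.commute)
    then show ?thesis by (simp add: J_def eta_eq)
  qed
  ultimately show ?thesis
    by (simp only: P_star_def state_star_def J_def q_def comp_apply)
qed

section \<open>State operators\<close>

lemma state_operator_add:
    "state_operator \<tau> \<Longrightarrow> orthogonal_mv a b \<Longrightarrow> \<tau> (a \<boxplus> b) = \<tau> a \<boxplus> \<tau> b"
  and state_operator_orthogonal:
    "state_operator \<tau> \<Longrightarrow> orthogonal_mv a b \<Longrightarrow> orthogonal_mv (\<tau> a) (\<tau> b)"
  and state_operator_one: "state_operator \<tau> \<Longrightarrow> \<tau> 1 = 1"
  and state_operator_idem: "state_operator \<tau> \<Longrightarrow> \<tau> (\<tau> a) = \<tau> a"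
  by (auto simp: state_operator_def)

lemma state_operator_mono:
  fixes a b :: "'a::sigma_mv_algebra"
  assumes "state_operator \<tau>" "a \<le> b"
  shows "\<tau> a \<le> \<tau> b"
  using state_operator_add[OF assms(1) orthogonal_mv_diff, of a b] mv_plus_diff_le[OF assms(2)]
  by (metis mv_le_plus)

lemma state_operator_neg:
  fixes a :: "'a::sigma_mv_algebra"
  assumes "state_operator \<tau>"
  shows "\<tau> (mv_neg a) = mv_neg (\<tau> a)"
  using state_operator_add[OF assms orthogonal_mv_neg, of a]
    state_operator_orthogonal[OF assms orthogonal_mv_neg, of a]
  by (intro mv_neg_unique) (auto simp: state_operator_one[OF assms])

lemma state_operator_range_iff: "state_operator \<tau> \<Longrightarrow> a \<in> range \<tau> \<longleftrightarrow> \<tau> a = a"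
  by (metis rangeE rangeI state_operator_idem)

lemma mv_state_comp_operator: "state_operator \<tau> \<Longrightarrow> mv_state s \<Longrightarrow> mv_state (s \<circ> \<tau>)"
  by (simp add: mv_state_def state_operator_def)

text \<open>States are homogeneous, and so is their composition with \<open>\<tau>\<close>; since
  lattice states separate points, homogeneity passes to \<open>\<tau>\<close> itself.\<close>

lemma state_operator_scale:
  fixes a :: "'a::convex_sigma_mv_algebra"
  assumes \<tau>: "state_operator \<tau>" and r: "r \<in> {0..1}"
  shows "\<tau> (mv_scale r a) = mv_scale r (\<tau> a)"
proof -
  have "\<omega> (\<tau> (mv_scale r a)) = \<omega> (mv_scale r (\<tau> a))" if "lattice_state \<omega>" for \<omega>
  proof -
    note \<omega> = lattice_state_mv_state[OF that]
    show ?thesis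
      using mv_state_scale[OF mv_state_comp_operator[OF \<tau> \<omega>] r, of a] mv_state_scale[OF \<omega> r, of "\<tau> a"]
      by simp
  qed
  then show ?thesis using lattice_state_eq_iff by blast
qed

text \<open>Strength keeps \<open>inf b (mv_neg a)\<close> in the range, and adding this meet to
  \<open>a\<close> is an orthogonal sum with value \<open>a \<boxplus> b\<close>.\<close>

lemma sub_mv_algebra_range:
  fixes \<tau> :: "'a::sigma_mv_algebra \<Rightarrow> 'a"
  assumes "strong_state_operator \<tau>"
  shows "sub_mv_algebra (range \<tau>)"
proof -
  have \<tau>: "state_operator \<tau>" and strong: "\<And>a b. \<tau> (inf (\<tau> a) (\<tau> b)) = inf (\<tau> a) (\<tau> b)"
    using assms by (auto simp: strong_state_operator_def)
  note iff = state_operator_range_iff[OF \<tau>]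
  show ?thesis
    unfolding sub_mv_algebra_def iff
  proof (intro conjI ballI)
    show "\<tau> 0 = 0" using state_operator_neg[OF \<tau>, of 1] by (simp add: state_operator_one[OF \<tau>])
    fix a assume a: "a \<in> range \<tau>"
    then have a': "\<tau> a = a" by (simp add: iff)
    show na: "\<tau> (mv_neg a) = mv_neg a" by (simp add: state_operator_neg[OF \<tau>] a')
    fix b assume "b \<in> range \<tau>"
    then have b': "\<tau> b = b" by (simp add: iff)
    have "\<tau> (inf b (mv_neg a)) = inf b (mv_neg a)"
      using strong[of b "mv_neg a"] by (simp add: b' na)
    then show "\<tau> (a \<boxplus> b) = a \<boxplus> b"
      using state_operator_add[OF \<tau> orthogonal_mv_inf_neg, of a b]
      by (metis a' mv_plus_eq_plus_inf)
  qed
qed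

lemma sub_mv_algebra_sup:
  fixes N :: "'a::sigma_mv_algebra set"
  assumes "sub_mv_algebra N" "a \<in> N" "b \<in> N"
  shows "sup a b \<in> N"
  using assms mv_plus_diff[of b a] by (metis mv_diff_def sub_mv_algebra_def)

text \<open>A countable supremum is the limit of the increasing suprema of finite subfamilies. These
  are fixed by \<open>\<tau>\<close>, and sigma-additivity carries this over to the limit.\<close>

lemma sigma_mv_subalgebra_range:
  fixes \<tau> :: "'a::sigma_mv_algebra \<Rightarrow> 'a"
  assumes strong: "strong_state_operator \<tau>" and \<sigma>: "sigma_additive_operator \<tau>"
  shows "sigma_mv_subalgebra (range \<tau>)"
  unfolding sigma_mv_subalgebra_def
proof (intro conjI allI impI)
  have \<tau>: "state_operator \<tau>" using strong by (simp add: strong_state_operator_def)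
  show sub: "sub_mv_algebra (range \<tau>)" by (rule sub_mv_algebra_range[OF strong])
  fix A :: "'a set" assume A: "countable A" "A \<subseteq> range \<tau>"
  show "Sup A \<in> range \<tau>"
  proof (cases "A = {}")
    case True
    have "Sup {} \<le> (0::'a)" by (rule ccSup_least) auto
    then show ?thesis using sub True by (simp add: sub_mv_algebra_def)
  next
    case False
    define a where "a = from_nat_into A"
    have a: "range a = A" unfolding a_def using A(1) False by simp
    define u where "u n = Sup (a ` {..n})" for n
    have u: "u n \<in> range \<tau>" for n
    proof (induction n)
      case 0
      then show ?case using a A(2) by (auto simp: u_def)
    next
      case (Suc n)
      have "u (Suc n) = sup (a (Suc n)) (u n)"
        unfolding u_def by (simp add: atMost_Suc ccSup_insert)
      moreover have "a (Suc n) \<in> range \<tau>" using a A(2) by blast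
      ultimately show ?case using sub_mv_algebra_sup[OF sub _ Suc] by (simp only:)
    qed
    have "increases_to u (Sup A)"
      unfolding increases_to_def
    proof (intro conjI allI impI)
      show "incseq u"
        unfolding u_def by (intro monoI ccSup_subset_mono) auto
      show "u n \<le> Sup A" for n
        unfolding u_def using a A(1) by (intro ccSup_subset_mono) auto
      fix v assume v: "\<forall>n. u n \<le> v"
      have "a n \<le> v" for n
      proof -
        have "a n \<le> u n" unfolding u_def by (rule ccSup_upper) auto
        with v show ?thesis by (blast intro: order_trans)
      qed
      then show "Sup A \<le> v" using a A(1) by (intro ccSup_least) auto
    qed
    then have "increases_to (\<lambda>n. \<tau> (u n)) (\<tau> (Sup A))"
      using \<sigma> by (simp add: sigma_additive_operator_def)
    moreover have "\<tau> (u n) = u n" for n using u state_operator_range_iff[OF \<tau>] by blast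
    ultimately have "\<tau> (Sup A) = Sup A"
      using \<open>increases_to u (Sup A)\<close> increases_to_unique by simp
    then show ?thesis by (metis rangeI)
  qed
qed

text \<open>Split \<open>a\<close> along \<open>b\<close>. The image of \<open>a \<ominus> b\<close>
  stays below \<open>mv_neg b\<close>, which is disjoint from a Boolean \<open>b\<close>, so below
  \<open>b\<close> only the image of \<open>inf a b\<close> contributes to
  \<open>\<tau> a\<close>.\<close>

lemma state_operator_inf_boolean:
  fixes a b :: "'a::sigma_mv_algebra"
  assumes \<tau>: "state_operator \<tau>" and b: "\<tau> b = b" "b \<boxplus> b = b"
  shows "\<tau> (inf a b) = inf (\<tau> a) b"
proof (rule order_antisym)
  show "\<tau> (inf a b) \<le> inf (\<tau> a) b"
    using state_operator_mono[OF \<tau>, of "inf a b" a] state_operator_mono[OF \<tau>, of "inf a b" b] b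
    by simp
  have "\<tau> (a \<ominus> b) \<le> mv_neg b"
    using state_operator_mono[OF \<tau> mv_diff_le_neg[of a b]] by (simp add: state_operator_neg[OF \<tau>] b)
  then have "inf b (\<tau> (a \<ominus> b)) \<le> inf b (mv_neg b)" by (rule inf_mono[OF order_refl])
  then have "inf b (\<tau> (a \<ominus> b)) = 0" by (simp add: boolean_inf_neg[OF b(2)])
  moreover have "\<tau> a = \<tau> (inf a b) \<boxplus> \<tau> (a \<ominus> b)"
    using state_operator_add[OF \<tau> mv_orthogonal_inf_diff, of a b] by (simp add: mv_inf_diff)
  ultimately have "inf b (\<tau> a) \<le> inf b (\<tau> (inf a b))"
    using mv_inf_plus_le[of b "\<tau> (inf a b)" "\<tau> (a \<ominus> b)"] by simp
  then show "inf (\<tau> a) b \<le> \<tau> (inf a b)" by (simp add: inf_commute)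
qed

section \<open>Transport along the star map, and the conditional expectation\<close>

lemma star_inject: "star a = star b \<longleftrightarrow> a = (b::'a::convex_sigma_mv_algebra)"
proof
  assume *: "star a = star b"
  have "\<omega> a = \<omega> b" if "lattice_state \<omega>" for \<omega>
    using fun_cong[OF *, of \<omega>] that by (simp add: extremal_state_iff_lattice_state[symmetric])
  then show "a = b" using lattice_state_eq_iff by blast
qed simp

lemma star_in_C1: "star a \<in> C1"
proof -
  have "continuous_on XM (star a) \<longleftrightarrow> continuous_on XM (\<lambda>\<omega>. \<omega> a)"
    by (rule continuous_on_cong) auto
  then show ?thesis
    using star_in_PiE[of a] continuous_on_eval[of XM a] by (simp add: C1_def)
qed

lemma operator_star_star:
  "operator_star \<tau> (star a) = star (\<tau> (a::'a::convex_sigma_mv_algebra))"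
proof -
  have "the_inv star (star a) = a" by (rule the_inv_f_f) (auto simp: inj_def star_inject)
  then show ?thesis by (simp add: operator_star_def star_in_C1)
qed

theorem theorem7p8:
  fixes \<tau> :: "'a::convex_sigma_mv_algebra \<Rightarrow> 'a"
  assumes "strong_state_operator \<tau>"
    and "sigma_additive_operator \<tau>"
    and "\<exists>s :: 'a \<Rightarrow> real. sigma_additive_state s"
  shows "\<exists>(N :: 'a set) (m :: 'a \<Rightarrow> real).
    sigma_mv_subalgebra N \<and> convex_sub N \<and>
    sigma_additive_state m \<and>
    (\<forall>a. mv_cond_exp N m a (operator_star \<tau> (star a)))"
proof -
  from assms(3) obtain s :: "'a \<Rightarrow> real" where s: "sigma_additive_state s" ..
  have \<tau>: "state_operator \<tau>" using assms(1) by (simp add: strong_state_operator_def)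
  note N_iff = state_operator_range_iff[OF \<tau>]
  have convex: "convex_sub (range \<tau>)"
    unfolding convex_sub_def N_iff by (simp add: state_operator_scale[OF \<tau>] N_iff)
  have m: "sigma_additive_state (s \<circ> \<tau>)"
    using s assms(2) mv_state_comp_operator[OF \<tau>]
    by (simp add: sigma_additive_state_def sigma_additive_operator_def)
  interpret N: tribe_with_constants XM "star_tribe (range \<tau>)"
    using convex N_iff[of 1] state_operator_one[OF \<tau>] by (intro tribe_with_constants_star_tribe) auto
  have "mv_cond_exp (range \<tau>) (s \<circ> \<tau>) a (operator_star \<tau> (star a))" for a
    unfolding mv_cond_exp_def operator_star_star
  proof (intro conjI ballI)
    show "star (\<tau> a) \<in> borel_measurable (sigma XM (tribe_sets XM (star_tribe (range \<tau>))))"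
      by (intro N.measurable star_in_star_tribe) simp
    fix b assume "b \<in> boolean_elements (range \<tau>)"
    then have b: "\<tau> b = b" "b \<boxplus> b = b" using N_iff[of b] by (auto simp: boolean_elements_def)
    \<comment> \<open>Both sides equal \<open>s (inf (\<tau> a) b)\<close>: on the left because
      \<open>\<tau>\<close> is idempotent, on the right by pulling out \<open>b\<close>.\<close>
    have "(s \<circ> \<tau>) (inf (\<tau> a) b) = (s \<circ> \<tau>) (inf a b)"
      by (simp add: state_operator_inf_boolean[OF \<tau> b] state_operator_idem[OF \<tau>])
    then show "has_bochner_integral (P_star (s \<circ> \<tau>) b) (star (\<tau> a)) ((s \<circ> \<tau>) (inf a b))"
      using integral_P_star[OF m b(2), of "\<tau> a"] by (simp only:)
  qed
  then show ?thesis
    using sigma_mv_subalgebra_range[OF assms(1,2)] convex m by blast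
qed

end
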